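(* Let $T:M\to M$, the transition probabilities $\{P_\varepsilon(x,\cdot)\}_{x\in M}$, $\varepsilon>0$, and the Banach space $\mathcal B(M)$ be as described in the context, so that (P1), (P2), (B1), (B2), (B3), (LY) and (RLY) hold. Then for every sufficiently small $\varepsilon>0$, the support of any ergodic acsm of the random system contains exactly one least element.
   Context: Initial system. $M\subset\mathbb R^q$ is compact with $\overline{\mathrm{int}\,M}=M$, $d$ is the Euclidean distance, $\mathcal A$ the Borel $\sigma$-algebra, $m$ normalized Lebesgue measure on $M$ ($m(M)=1$; $dz$ also denotes integration against $m$), and $B_\varepsilon(x)=\{y\in M: d(x,y)<\varepsilon\}$. $T:M\to M$ is measurable and non-singular with respect to $m$, and its set of discontinuities $\mathcal D_T$ satisfies $m(\mathcal D_T)=0$. The transfer operator $\mathcal L:L^1_m\to L^1_m$ is defined by $\int_M g_1\, (g_2\circ T)\,dm=\int_M (\mathcal L g_1)\, g_2\,dm$ for $g_1\in L^1_m$, $g_2\in L^\infty_m$. An acim is a $T$-invariant probability measure absolutely continuous with respect to $m$. Random system. For each $\varepsilon>0$ there is a Markov chain $(\mathcal X_n^\varepsilon)_{n\ge0}$ on $M$ with transition probabilities $P_\varepsilon(x,\cdot)$ such that: (P1) for all $x\in M$, $P_\varepsilon(x,\cdot)$ is absolutely continuous with respect to $m$, with density $p_\varepsilon(x,\cdot)$; (P2) $\mathrm{supp}\,P_\varepsilon(x,\cdot)=B_\varepsilon(Tx)$ for all $x\in M$, meaning that $p_\varepsilon(x,y)>0$ if $y\in B_\varepsilon(Tx)$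 and $P_\varepsilon(x,M\setminus B_\varepsilon(Tx))=0$. A probability measure $\mu_\varepsilon$ is stationary if $\mu_\varepsilon(A)=\int_M P_\varepsilon(x,A)\,d\mu_\varepsilon(x)$ for all $A\in\mathcal A$; it is an acsm if it is moreover absolutely continuous with respect to $m$. A stationary measure $\mu_\varepsilon$ is ergodic if every $A\in\mathcal A$ with $P_\varepsilon(x,A)=\mathbf 1_A(x)$ for $\mu_\varepsilon$-a.e. $x$ satisfies $\mu_\varepsilon(A)\in\{0,1\}$. The random transfer operator is $\mathcal L_\varepsilon g(x)=\int_M p_\varepsilon(z,x)g(z)\,dz$; densities of acsms are exactly the probability densities fixed by $\mathcal L_\varepsilon$. Banach space. $\mathcal B(M)\subset L^1_m$ is a Banach space such that: (B1) $1\in\mathcal B(M)$; (B2) the set of discontinuities of any $f\in\mathcal B(M)$ has Lebesgue measure zero; (B3) there is a semi-norm $|\cdot|$ on $\mathcal B(M)$ such that, for the complete norm $\|\cdot\|_{\mathcal B}=|\cdot|+\|\cdot\|_1$ ($\|\cdot\|_1$ the $L^1_m$ norm), the unit ball of $\mathcal B(M)$ is compact in $L^1_m$. There exist $\eta\in(0,1)$ and $D\in(0,\infty)$ such that for all $f\in\mathcal B(M)$ and all sufficiently small $\varepsilon>0$ (with $\mathcal Lf,\mathcal L_\varepsilon f\in\mathcal B(M)$): (LY) $|\mathcal Lf|\le\eta|f|+D\|f\|_1$; (RLY) $|\mathcal L_\varepsilon f|\le\eta|f|+D\|f\|_1$. Ergodic components. Under (LY) there are finitely many ergodic acims $\mu_1=w_1m,\dots,\mu_l=w_lm$,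 whose supports $\Lambda_k=\mathrm{supp}\,\mu_k$ are mutually disjoint up to Lebesgue null sets. Pseudo-orbits and least elements. An $\varepsilon$-pseudo-orbit is a finite set $\{x_i\}_{i=0}^n\subset M$ with $d(Tx_i,x_{i+1})<\varepsilon$ for $i=0,\dots,n-1$. Write $\Lambda_i\to\Lambda_j$ if for every $\varepsilon>0$ there is an $\varepsilon$-pseudo-orbit $\{x_s\}_{s=0}^k$ with $x_0\in\Lambda_i$, $x_k\in\Lambda_j$. Write $\Lambda_i\sim\Lambda_j$ if $\Lambda_i\to\Lambda_j$ and $\Lambda_j\to\Lambda_i$; this is an equivalence relation on $\{\Lambda_1,\dots,\Lambda_l\}$. $\tilde\Lambda_i$ is the equivalence class of $\Lambda_i$, identified, when regarded as a subset of $M$, with the union of its members. Write $\tilde\Lambda_i\to\tilde\Lambda_j$ if $\Lambda_k\to\Lambda_s$ for any $\Lambda_k\in\tilde\Lambda_i$, $\Lambda_s\in\tilde\Lambda_j$. $\tilde\Lambda_i$ is a least element if there is no class $\tilde\Lambda_j\ne\tilde\Lambda_i$ with $\tilde\Lambda_i\to\tilde\Lambda_j$.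
   Formalization: Two hypotheses are added, without which the claim is false: the value of T at each discontinuity is a limit of values of T along continuity points converging to it, and the Banach space B(M) is dense in L^1_m. *)

theory Defs
  imports "HOL-Probability.Probability"
begin

subsection \<open>The initial system\<close>

definition nleb :: "'a::euclidean_space set \<Rightarrow> 'a measure" where
  "nleb M = uniform_measure (restrict_space lborel M) M"

definition relball :: "'a::metric_space set \<Rightarrow> real \<Rightarrow> 'a \<Rightarrow> 'a set" where
  "relball M \<epsilon> x = {y \<in> M. dist x y < \<epsilon>}"

definition discontinuities :: "'a::t2_space set \<Rightarrow> ('a \<Rightarrow> 'b::topological_space) \<Rightarrow> 'a set" where
  "discontinuities M f = {x \<in> M. \<not> continuous (at x within M) f}"

definition initial_system :: "'a::euclidean_space set \<Rightarrow> ('a \<Rightarrow> 'a) \<Rightarrow> bool" where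
  "initial_system M T \<longleftrightarrow>
     compact M \<and> M \<noteq> {} \<and> closure (interior M) = M \<and>
     T \<in> nleb M \<rightarrow>\<^sub>M nleb M \<and>
     absolutely_continuous (nleb M) (distr (nleb M) (nleb M) T) \<and>
     discontinuities M T \<in> null_sets (nleb M)"

text \<open>
  Elements of \<open>L\<^sup>1\<close> are represented by integrable functions, to be read up to equality almost
  everywhere; accordingly the topology below is that of a pseudometric.
\<close>

definition L1 :: "'a::euclidean_space set \<Rightarrow> ('a \<Rightarrow> real) set" where
  "L1 M = {f. integrable (nleb M) f}"

definition L1_norm :: "'a::euclidean_space set \<Rightarrow> ('a \<Rightarrow> real) \<Rightarrow> real" where
  "L1_norm M f = (LINT x|nleb M. \<bar>f x\<bar>)"

definition L1_topology :: "'a::euclidean_space set \<Rightarrow> ('a \<Rightarrow> real) topology" where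
  "L1_topology M = topology (\<lambda>U. U \<subseteq> L1 M \<and>
     (\<forall>f\<in>U. \<exists>r>0. \<forall>g\<in>L1 M. L1_norm M (\<lambda>x. g x - f x) < r \<longrightarrow> g \<in> U))"

lemma openin_L1_topology:
  "openin (L1_topology M) U \<longleftrightarrow> U \<subseteq> L1 M \<and>
     (\<forall>f\<in>U. \<exists>r>0. \<forall>g\<in>L1 M. L1_norm M (\<lambda>x. g x - f x) < r \<longrightarrow> g \<in> U)"
proof -
  have "istopology (\<lambda>U. U \<subseteq> L1 M \<and>
     (\<forall>f\<in>U. \<exists>r>0. \<forall>g\<in>L1 M. L1_norm M (\<lambda>x. g x - f x) < r \<longrightarrow> g \<in> U))" (is "istopology ?P")
    unfolding istopology_def
  proof (intro conjI allI impI)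
    fix S U assume S: "?P S" and U: "?P U"
    show "S \<inter> U \<subseteq> L1 M" using S by blast
    show "\<forall>f\<in>S \<inter> U. \<exists>r>0. \<forall>g\<in>L1 M. L1_norm M (\<lambda>x. g x - f x) < r \<longrightarrow> g \<in> S \<inter> U"
    proof
      fix f assume f: "f \<in> S \<inter> U"
      obtain r where "r > 0" "\<forall>g\<in>L1 M. L1_norm M (\<lambda>x. g x - f x) < r \<longrightarrow> g \<in> S"
        using S f by blast
      moreover obtain r' where "r' > 0" "\<forall>g\<in>L1 M. L1_norm M (\<lambda>x. g x - f x) < r' \<longrightarrow> g \<in> U"
        using U f by blast
      ultimately show "\<exists>r>0. \<forall>g\<in>L1 M. L1_norm M (\<lambda>x. g x - f x) < r \<longrightarrow> g \<in> S \<inter> U"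
        by (intro exI[of _ "min r r'"]) auto
    qed
  next
    fix K assume K: "\<forall>U\<in>K. ?P U"
    show "\<Union>K \<subseteq> L1 M" using K by blast
    show "\<forall>f\<in>\<Union>K. \<exists>r>0. \<forall>g\<in>L1 M. L1_norm M (\<lambda>x. g x - f x) < r \<longrightarrow> g \<in> \<Union>K"
      using K by (meson Union_iff)
  qed
  then show ?thesis
    by (simp add: L1_topology_def)
qed

definition Linf :: "'a::euclidean_space set \<Rightarrow> ('a \<Rightarrow> real) set" where
  "Linf M = {g \<in> borel_measurable (nleb M). \<exists>C. AE x in nleb M. \<bar>g x\<bar> \<le> C}"

text \<open>The defining identity determines the transfer operator up to null sets; some version is chosen.\<close>

definition transfer_op :: "'a::euclidean_space set \<Rightarrow> ('a \<Rightarrow> 'a) \<Rightarrow> ('a \<Rightarrow> real) \<Rightarrow> 'a \<Rightarrow> real" where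
  "transfer_op M T g\<^sub>1 = (SOME h. h \<in> L1 M \<and>
     (\<forall>g\<^sub>2\<in>Linf M. (LINT x|nleb M. g\<^sub>1 x * g\<^sub>2 (T x)) = (LINT x|nleb M. h x * g\<^sub>2 x)))"

definition acim :: "'a::euclidean_space set \<Rightarrow> ('a \<Rightarrow> 'a) \<Rightarrow> 'a measure \<Rightarrow> bool" where
  "acim M T \<mu> \<longleftrightarrow> prob_space \<mu> \<and> sets \<mu> = sets (nleb M) \<and>
     distr \<mu> \<mu> T = \<mu> \<and> absolutely_continuous (nleb M) \<mu>"

definition ergodic_acim :: "'a::euclidean_space set \<Rightarrow> ('a \<Rightarrow> 'a) \<Rightarrow> 'a measure \<Rightarrow> bool" where
  "ergodic_acim M T \<mu> \<longleftrightarrow> acim M T \<mu> \<and>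
     (\<forall>A\<in>sets (nleb M). T -` A \<inter> M = A \<longrightarrow> measure \<mu> A \<in> {0, 1})"

subsection \<open>The random system\<close>

definition transition_probabilities ::
    "'a::euclidean_space set \<Rightarrow> (real \<Rightarrow> 'a \<Rightarrow> 'a measure) \<Rightarrow> bool" where
  "transition_probabilities M P \<longleftrightarrow> (\<forall>\<epsilon>>0. P \<epsilon> \<in> nleb M \<rightarrow>\<^sub>M prob_algebra (nleb M))"

text \<open>
  Joint measurability of the densities is what makes the random transfer operator below a
  well-defined operator on \<open>L\<^sup>1\<close>.
\<close>

definition P1 :: "'a::euclidean_space set \<Rightarrow> (real \<Rightarrow> 'a \<Rightarrow> 'a measure)
    \<Rightarrow> (real \<Rightarrow> 'a \<Rightarrow> 'a \<Rightarrow> real) \<Rightarrow> bool" where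
  "P1 M P p \<longleftrightarrow> (\<forall>\<epsilon>>0.
     (\<lambda>(x, y). p \<epsilon> x y) \<in> borel_measurable (nleb M \<Otimes>\<^sub>M nleb M) \<and>
     (\<forall>x\<in>M. (\<forall>y\<in>M. p \<epsilon> x y \<ge> 0) \<and> P \<epsilon> x = density (nleb M) (\<lambda>y. ennreal (p \<epsilon> x y))))"

definition P2 :: "'a::euclidean_space set \<Rightarrow> ('a \<Rightarrow> 'a) \<Rightarrow> (real \<Rightarrow> 'a \<Rightarrow> 'a measure)
    \<Rightarrow> (real \<Rightarrow> 'a \<Rightarrow> 'a \<Rightarrow> real) \<Rightarrow> bool" where
  "P2 M T P p \<longleftrightarrow> (\<forall>\<epsilon>>0. \<forall>x\<in>M.
     (\<forall>y\<in>relball M \<epsilon> (T x). p \<epsilon> x y > 0) \<and> emeasure (P \<epsilon> x) (M - relball M \<epsilon> (T x)) = 0)"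

definition stationary :: "'a::euclidean_space set \<Rightarrow> ('a \<Rightarrow> 'a measure) \<Rightarrow> 'a measure \<Rightarrow> bool" where
  "stationary M Q \<mu> \<longleftrightarrow> prob_space \<mu> \<and> sets \<mu> = sets (nleb M) \<and>
     (\<forall>A\<in>sets (nleb M). emeasure \<mu> A = (\<integral>\<^sup>+x. emeasure (Q x) A \<partial>\<mu>))"

definition acsm :: "'a::euclidean_space set \<Rightarrow> ('a \<Rightarrow> 'a measure) \<Rightarrow> 'a measure \<Rightarrow> bool" where
  "acsm M Q \<mu> \<longleftrightarrow> stationary M Q \<mu> \<and> absolutely_continuous (nleb M) \<mu>"

definition ergodic_acsm :: "'a::euclidean_space set \<Rightarrow> ('a \<Rightarrow> 'a measure) \<Rightarrow> 'a measure \<Rightarrow> bool" where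
  "ergodic_acsm M Q \<mu> \<longleftrightarrow> acsm M Q \<mu> \<and>
     (\<forall>A\<in>sets (nleb M). (AE x in \<mu>. measure (Q x) A = indicator A x) \<longrightarrow> measure \<mu> A \<in> {0, 1})"

definition random_transfer_op ::
    "'a::euclidean_space set \<Rightarrow> ('a \<Rightarrow> 'a \<Rightarrow> real) \<Rightarrow> ('a \<Rightarrow> real) \<Rightarrow> 'a \<Rightarrow> real" where
  "random_transfer_op M q g x = (LINT z|nleb M. q z x * g z)"

subsection \<open>The Banach space\<close>

text \<open>
  A linear subspace \<open>B\<close> of \<open>L\<^sup>1\<close> with a semi-norm \<open>sn\<close> on it. The second line expresses that both are
  given on classes of almost everywhere equal functions.
\<close>

definition seminormed_subspace ::
    "'a::euclidean_space set \<Rightarrow> ('a \<Rightarrow> real) set \<Rightarrow> (('a \<Rightarrow> real) \<Rightarrow> real) \<Rightarrow> bool" where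
  "seminormed_subspace M B sn \<longleftrightarrow>
     B \<subseteq> L1 M \<and>
     (\<forall>f\<in>B. \<forall>g\<in>L1 M. (AE x in nleb M. f x = g x) \<longrightarrow> g \<in> B \<and> sn g = sn f) \<and>
     (\<lambda>x. 0) \<in> B \<and>
     (\<forall>f\<in>B. \<forall>g\<in>B. (\<lambda>x. f x + g x) \<in> B \<and> sn (\<lambda>x. f x + g x) \<le> sn f + sn g) \<and>
     (\<forall>f\<in>B. \<forall>c. (\<lambda>x. c * f x) \<in> B \<and> sn (\<lambda>x. c * f x) = \<bar>c\<bar> * sn f) \<and>
     (\<forall>f\<in>B. 0 \<le> sn f)"

definition B_norm ::
    "'a::euclidean_space set \<Rightarrow> (('a \<Rightarrow> real) \<Rightarrow> real) \<Rightarrow> ('a \<Rightarrow> real) \<Rightarrow> real" where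
  "B_norm M sn f = sn f + L1_norm M f"

definition B_complete ::
    "'a::euclidean_space set \<Rightarrow> ('a \<Rightarrow> real) set \<Rightarrow> (('a \<Rightarrow> real) \<Rightarrow> real) \<Rightarrow> bool" where
  "B_complete M B sn \<longleftrightarrow> (\<forall>f :: nat \<Rightarrow> 'a \<Rightarrow> real.
     (\<forall>n. f n \<in> B) \<and>
     (\<forall>e>0. \<exists>N. \<forall>i\<ge>N. \<forall>j\<ge>N. B_norm M sn (\<lambda>x. f i x - f j x) < e) \<longrightarrow>
     (\<exists>g\<in>B. (\<lambda>n. B_norm M sn (\<lambda>x. f n x - g x)) \<longlonglongrightarrow> 0))"

definition B1 :: "('a \<Rightarrow> real) set \<Rightarrow> bool" where
  "B1 B \<longleftrightarrow> (\<lambda>x. 1) \<in> B"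

text \<open>
  Discontinuities are a property of functions, not of classes: every class in \<open>B\<close> is required to
  have a version that is continuous almost everywhere (as for functions of bounded variation).
\<close>

definition B2 :: "'a::euclidean_space set \<Rightarrow> ('a \<Rightarrow> real) set \<Rightarrow> bool" where
  "B2 M B \<longleftrightarrow> (\<forall>f\<in>B. \<exists>g\<in>L1 M. (AE x in nleb M. g x = f x) \<and>
     discontinuities M g \<in> null_sets (nleb M))"

definition B3 ::
    "'a::euclidean_space set \<Rightarrow> ('a \<Rightarrow> real) set \<Rightarrow> (('a \<Rightarrow> real) \<Rightarrow> real) \<Rightarrow> bool" where
  "B3 M B sn \<longleftrightarrow> seminormed_subspace M B sn \<and> B_complete M B sn \<and>
     compactin (L1_topology M) {f \<in> B. B_norm M sn f \<le> 1}"

definition L1_dense :: "'a::euclidean_space set \<Rightarrow> ('a \<Rightarrow> real) set \<Rightarrow> bool" where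
  "L1_dense M B \<longleftrightarrow> (\<forall>g\<in>L1 M. \<forall>e>0. \<exists>f\<in>B. L1_norm M (\<lambda>x. f x - g x) < e)"

definition LY :: "'a::euclidean_space set \<Rightarrow> ('a \<Rightarrow> 'a) \<Rightarrow> ('a \<Rightarrow> real) set
    \<Rightarrow> (('a \<Rightarrow> real) \<Rightarrow> real) \<Rightarrow> real \<Rightarrow> real \<Rightarrow> bool" where
  "LY M T B sn \<eta> D \<longleftrightarrow> (\<forall>f\<in>B. transfer_op M T f \<in> B \<and>
     sn (transfer_op M T f) \<le> \<eta> * sn f + D * L1_norm M f)"

definition RLY :: "'a::euclidean_space set \<Rightarrow> (real \<Rightarrow> 'a \<Rightarrow> 'a \<Rightarrow> real) \<Rightarrow> ('a \<Rightarrow> real) set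
    \<Rightarrow> (('a \<Rightarrow> real) \<Rightarrow> real) \<Rightarrow> real \<Rightarrow> real \<Rightarrow> bool" where
  "RLY M p B sn \<eta> D \<longleftrightarrow> (\<exists>\<epsilon>\<^sub>1>0. \<forall>\<epsilon>. 0 < \<epsilon> \<and> \<epsilon> < \<epsilon>\<^sub>1 \<longrightarrow>
     (\<forall>f\<in>B. random_transfer_op M (p \<epsilon>) f \<in> B \<and>
        sn (random_transfer_op M (p \<epsilon>) f) \<le> \<eta> * sn f + D * L1_norm M f))"

subsection \<open>Pseudo-orbits and least elements\<close>

definition measure_support :: "'a::topological_space measure \<Rightarrow> 'a set" where
  "measure_support \<mu> =
     {x \<in> space \<mu>. \<forall>U. open U \<and> x \<in> U \<longrightarrow> emeasure \<mu> (U \<inter> space \<mu>) > 0}"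

definition ergodic_supports :: "'a::euclidean_space set \<Rightarrow> ('a \<Rightarrow> 'a) \<Rightarrow> 'a set set" where
  "ergodic_supports M T = measure_support ` {\<mu>. ergodic_acim M T \<mu>}"

definition pseudo_orbit ::
    "'a::metric_space set \<Rightarrow> ('a \<Rightarrow> 'a) \<Rightarrow> real \<Rightarrow> nat \<Rightarrow> (nat \<Rightarrow> 'a) \<Rightarrow> bool" where
  "pseudo_orbit M T \<epsilon> n x \<longleftrightarrow> (\<forall>i\<le>n. x i \<in> M) \<and> (\<forall>i<n. dist (T (x i)) (x (Suc i)) < \<epsilon>)"

definition leads_to :: "'a::metric_space set \<Rightarrow> ('a \<Rightarrow> 'a) \<Rightarrow> 'a set \<Rightarrow> 'a set \<Rightarrow> bool" where
  "leads_to M T \<Lambda> \<Lambda>' \<longleftrightarrow>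
     (\<forall>\<epsilon>>0. \<exists>k x. pseudo_orbit M T \<epsilon> k x \<and> x 0 \<in> \<Lambda> \<and> x k \<in> \<Lambda>')"

definition support_equiv :: "'a::euclidean_space set \<Rightarrow> ('a \<Rightarrow> 'a) \<Rightarrow> ('a set \<times> 'a set) set" where
  "support_equiv M T = {(\<Lambda>, \<Lambda>'). \<Lambda> \<in> ergodic_supports M T \<and> \<Lambda>' \<in> ergodic_supports M T \<and>
     leads_to M T \<Lambda> \<Lambda>' \<and> leads_to M T \<Lambda>' \<Lambda>}"

definition support_classes :: "'a::euclidean_space set \<Rightarrow> ('a \<Rightarrow> 'a) \<Rightarrow> 'a set set set" where
  "support_classes M T = ergodic_supports M T // support_equiv M T"

definition class_leads_to ::
    "'a::metric_space set \<Rightarrow> ('a \<Rightarrow> 'a) \<Rightarrow> 'a set set \<Rightarrow> 'a set set \<Rightarrow> bool" where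
  "class_leads_to M T C C' \<longleftrightarrow> (\<forall>\<Lambda>\<in>C. \<forall>\<Lambda>'\<in>C'. leads_to M T \<Lambda> \<Lambda>')"

definition least_element :: "'a::euclidean_space set \<Rightarrow> ('a \<Rightarrow> 'a) \<Rightarrow> 'a set set \<Rightarrow> bool" where
  "least_element M T C \<longleftrightarrow> C \<in> support_classes M T \<and>
     \<not> (\<exists>C'\<in>support_classes M T. C' \<noteq> C \<and> class_leads_to M T C C')"

subsection \<open>Values at discontinuities\<close>

text \<open>
  Pseudo-orbits evaluate \<open>T\<close> at individual points, so they depend on the values of \<open>T\<close> on the null
  set of its discontinuities, whereas absolutely continuous measures do not. This normalisation
  (vacuous for continuous \<open>T\<close>, and true for piecewise continuous maps whose values at the break
  points are one-sided limits) ties these values to the values at points of continuity.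
\<close>

definition limit_values :: "'a::metric_space set \<Rightarrow> ('a \<Rightarrow> 'a) \<Rightarrow> bool" where
  "limit_values M T \<longleftrightarrow> (\<forall>x\<in>discontinuities M T. \<exists>z :: nat \<Rightarrow> 'a.
     (\<forall>n. z n \<in> M - discontinuities M T) \<and> z \<longlonglongrightarrow> x \<and> (\<lambda>n. T (z n)) \<longlonglongrightarrow> T x)"

end

theory Submission
  imports Defs
begin

text \<open>
  Let \<open>S\<close> be the support of an ergodic acsm. For almost every \<open>x \<in> S\<close> stationarity and (P2) give
  \<open>B\<^sub>\<epsilon>(Tx) \<subseteq> S\<close>; this extends to every \<open>x\<close> in the interior of \<open>S\<close> relative to \<open>M\<close>, so that
  \<open>\<epsilon>\<close>-pseudo-orbits starting in the interior stay there. The interior has positive Lebesgue measure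
  and is forward invariant, so by (LY) and compactness it carries an ergodic acim, and its support,
  as well as every \<open>\<Lambda>\<close> that this support leads to, is contained in \<open>S\<close>. As there are only finitely
  many \<open>\<Lambda>\<close>, a least element is among them. Conversely, ergodicity of the chain gives
  pseudo-orbits between any two \<open>\<Lambda>, \<Lambda>' \<subseteq> S\<close> with steps barely larger than \<open>\<epsilon>\<close>, and for \<open>\<epsilon>\<close> below a
  threshold determined by the finitely many \<open>\<Lambda>\<close> this means \<open>\<Lambda> \<rightarrow> \<Lambda>'\<close>; so two least elements
  in \<open>S\<close> coincide.
\<close>

subsection \<open>Pseudo-orbits between supports of ergodic measures\<close>

text \<open>The obstacle is the gap between almost everywhere and everywhere: pseudo-orbits,
  supports and least elements are pointwise notions, while stationarity, invariance and ergodicity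
  speak of almost every point. Three devices bridge it. An almost sure inclusion into the closed set
  \<open>S\<close> passes to a given point through a nearby point of continuity of \<open>T\<close>
  that is itself a support point; this asks for a whole relative neighbourhood inside
  \<open>S\<close>, hence the interior, and for \<open>limit_values\<close> at discontinuities. A
  point of a support is exchanged for a generic one by perturbing the step that leads to it; hence
  chains with at least one step. A set of full measure is only known to be dense in
  \<open>S\<close>, which costs an arbitrarily small enlargement of the last step; the strict
  \<open>\<epsilon> < \<epsilon>\<^sub>0\<close> pays for it.

  (LY) governs functions in \<open>B\<close> only, whereas the mass to be followed is the indicator
  of the interior. \<open>L1_dense\<close> supplies an approximation in \<open>B\<close>, possibly
  of varying sign, so invariant densities are signed at first and a positive part is taken at the
  end.\<close>

definition eps_step :: "'a::metric_space set \<Rightarrow> ('a \<Rightarrow> 'a) \<Rightarrow> real \<Rightarrow> 'a \<Rightarrow> 'a \<Rightarrow> bool" where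
  "eps_step M T e x y \<longleftrightarrow> x \<in> M \<and> y \<in> M \<and> dist (T x) y < e"

text \<open>With paths of a relation in place of indexed sequences, concatenation is transitivity
  and reachability arguments are rule inductions. \<open>x \<in> M\<close> stands apart because a
  path of length zero does not enforce it.\<close>

lemma pseudo_orbit_iff_rtranclp:
  "(\<exists>k z. pseudo_orbit M T e k z \<and> z 0 = x \<and> z k = y) \<longleftrightarrow> x \<in> M \<and> (eps_step M T e)\<^sup>*\<^sup>* x y"
proof
  assume "\<exists>k z. pseudo_orbit M T e k z \<and> z 0 = x \<and> z k = y"
  then obtain k z where z: "pseudo_orbit M T e k z" "z 0 = x" "z k = y" by blast
  have "(eps_step M T e ^^ k) x y"
    unfolding relpowp_fun_conv using z by (intro exI[of _ z]) (auto simp: pseudo_orbit_def eps_step_def)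
  then show "x \<in> M \<and> (eps_step M T e)\<^sup>*\<^sup>* x y"
    using z by (auto simp: pseudo_orbit_def dest: relpowp_imp_rtranclp)
next
  assume x: "x \<in> M \<and> (eps_step M T e)\<^sup>*\<^sup>* x y"
  then obtain k where "(eps_step M T e ^^ k) x y" using rtranclp_imp_relpowp by metis
  then obtain z where z: "z 0 = x" "z k = y" "\<forall>i<k. eps_step M T e (z i) (z (Suc i))"
    unfolding relpowp_fun_conv by blast
  have "z i \<in> M" if "i \<le> k" for i
    using that x z by (cases i) (auto simp: eps_step_def)
  then have "pseudo_orbit M T e k z" using z by (auto simp: pseudo_orbit_def eps_step_def)
  then show "\<exists>k z. pseudo_orbit M T e k z \<and> z 0 = x \<and> z k = y" using z by blast
qed

lemma leads_to_iff_rtranclp: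
  "leads_to M T A A' \<longleftrightarrow> (\<forall>e>0. \<exists>x\<in>A \<inter> M. \<exists>y\<in>A'. (eps_step M T e)\<^sup>*\<^sup>* x y)"
proof -
  have "(\<exists>k x. pseudo_orbit M T e k x \<and> x 0 \<in> A \<and> x k \<in> A') \<longleftrightarrow>
      (\<exists>x\<in>A \<inter> M. \<exists>y\<in>A'. (eps_step M T e)\<^sup>*\<^sup>* x y)" for e
  proof -
    have "(\<exists>k x. pseudo_orbit M T e k x \<and> x 0 \<in> A \<and> x k \<in> A') \<longleftrightarrow>
        (\<exists>x\<in>A. \<exists>y\<in>A'. \<exists>k z. pseudo_orbit M T e k z \<and> z 0 = x \<and> z k = y)" by blast
    then show ?thesis unfolding pseudo_orbit_iff_rtranclp by blast
  qed
  then show ?thesis unfolding leads_to_def by simp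
qed

lemma eps_step_mono: "eps_step M T e x y \<Longrightarrow> e \<le> e' \<Longrightarrow> eps_step M T e' x y"
  by (auto simp: eps_step_def)

locale nonsingular_system =
  fixes M :: "'a::euclidean_space set" and T :: "'a \<Rightarrow> 'a"
  assumes initial: "initial_system M T"
begin

abbreviation "m \<equiv> nleb M"

section \<open>Normalized Lebesgue measure and supports of measures\<close>

lemma compact_M: "compact M" and nonempty_M: "M \<noteq> {}" and closure_interior_M: "closure (interior M) = M"
  and T_measurable[measurable]: "T \<in> m \<rightarrow>\<^sub>M m"
  and T_nonsingular: "absolutely_continuous m (distr m m T)"
  using initial unfolding initial_system_def by auto

lemma borel_M: "M \<in> sets borel"
  using compact_M compact_imp_closed borel_closed by metis

lemma space_m[simp]: "space m = M"
  using borel_M by (simp add: nleb_def)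

lemma sets_m_iff: "A \<in> sets m \<longleftrightarrow> A \<subseteq> M \<and> A \<in> sets borel"
  using borel_M by (simp add: nleb_def sets_restrict_space_iff)

lemma open_Int_sets_m: "open U \<Longrightarrow> U \<inter> M \<in> sets m"
  using borel_M by (auto simp: sets_m_iff)

lemma T_in_M: "x \<in> M \<Longrightarrow> T x \<in> M"
  using measurable_space[OF T_measurable] by simp

lemma funpow_T_in_M: "x \<in> M \<Longrightarrow> (T ^^ n) x \<in> M"
  by (induction n) (auto simp: T_in_M)

text \<open>The interior is dense in \<open>M\<close>, so an open set around a point of
  \<open>M\<close> meets it in a nonempty open set, which is not Lebesgue null.\<close>

lemma emeasure_lborel_open_pos:
  assumes "open U" "x \<in> U" "x \<in> M"
  shows "emeasure lborel (U \<inter> M) > 0"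
proof -
  have "U \<inter> interior M \<noteq> {}"
    using assms closure_interior_M open_Int_closure_eq_empty by blast
  moreover have "open (U \<inter> interior M)" using assms by blast
  ultimately have "\<not> negligible (U \<inter> interior M)" by (simp add: open_not_negligible)
  then have "U \<inter> interior M \<notin> null_sets lborel"
    by (metis null_sets_completionI negligible_iff_null_sets)
  moreover have "U \<inter> interior M \<in> sets lborel" using assms by auto
  ultimately have "emeasure lborel (U \<inter> interior M) > 0"
    by (auto simp: null_sets_def zero_less_iff_neq_zero)
  also have "\<dots> \<le> emeasure lborel (U \<inter> M)"
    using assms borel_M interior_subset by (intro emeasure_mono) auto
  finally show ?thesis .
qed

lemma emeasure_lborel_M: "emeasure lborel M \<noteq> 0" "emeasure lborel M \<noteq> \<infinity>"
proof -
  obtain x where "x \<in> M" using nonempty_M by blast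
  then show "emeasure lborel M \<noteq> 0" using emeasure_lborel_open_pos[of UNIV x] by simp
  show "emeasure lborel M \<noteq> \<infinity>"
    using compact_M emeasure_bounded_finite[of M] compact_imp_bounded by fastforce
qed

lemma prob_space_m: "prob_space m"
  unfolding nleb_def using emeasure_lborel_M borel_M
  by (intro prob_space_uniform_measure) (auto simp: emeasure_restrict_space)

sublocale m: prob_space m by (rule prob_space_m)

lemma emeasure_m_open_pos:
  assumes "open U" "x \<in> U" "x \<in> M"
  shows "emeasure m (U \<inter> M) > 0"
proof -
  have "emeasure m (U \<inter> M) = emeasure lborel (U \<inter> M) / emeasure lborel M"
    using assms(1) borel_M by (auto simp: nleb_def emeasure_restrict_space sets_restrict_space_iff
        intro!: arg_cong2[where f="(/)"] arg_cong[where f="emeasure lborel"])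
  then show ?thesis
    using emeasure_lborel_open_pos[OF assms] emeasure_lborel_M(2)
    by (simp add: ennreal_zero_less_divide less_top)
qed

text \<open>By second countability, countably many null sets from a basis cover the complement of
  the support.\<close>

lemma AE_support:
  assumes sets: "sets \<mu> = sets m"
  shows "AE x in \<mu>. x \<in> measure_support \<mu>"
proof -
  have sp: "space \<mu> = M" using sets_eq_imp_space_eq[OF sets] by simp
  obtain \<B> :: "'a set set" where \<B>: "countable \<B>" "topological_basis \<B>"
    using ex_countable_basis by blast
  define \<N> where "\<N> = {b \<inter> M | b. b \<in> \<B> \<and> emeasure \<mu> (b \<inter> M) = 0}"
  have "\<N> \<subseteq> (\<lambda>b. b \<inter> M) ` \<B>" by (auto simp: \<N>_def)
  then have "countable \<N>" by (rule countable_subset[OF _ countable_image[OF \<B>(1)]])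
  moreover have "N \<in> null_sets \<mu>" if "N \<in> \<N>" for N
    using that \<B>(2) topological_basis_open[OF \<B>(2)] open_Int_sets_m
    by (auto simp: \<N>_def null_sets_def sets)
  ultimately have "(\<Union>N\<in>\<N>. N) \<in> null_sets \<mu>" by (intro null_sets_UN') auto
  moreover have "{x \<in> space \<mu>. x \<notin> measure_support \<mu>} \<subseteq> (\<Union>N\<in>\<N>. N)"
  proof
    fix x assume "x \<in> {x \<in> space \<mu>. x \<notin> measure_support \<mu>}"
    then obtain U where U: "open U" "x \<in> U" "emeasure \<mu> (U \<inter> M) = 0" and x: "x \<in> M"
      by (auto simp: measure_support_def sp zero_less_iff_neq_zero)
    obtain b where b: "b \<in> \<B>" "x \<in> b" "b \<subseteq> U"
      using topological_basisE[OF \<B>(2) U(1,2)] by blast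
    have "emeasure \<mu> (b \<inter> M) \<le> emeasure \<mu> (U \<inter> M)"
      using b U open_Int_sets_m by (intro emeasure_mono) (auto simp: sets)
    then have "b \<inter> M \<in> \<N>" using U b by (auto simp: \<N>_def)
    then show "x \<in> (\<Union>N\<in>\<N>. N)" using b x by auto
  qed
  ultimately show ?thesis by (rule AE_I')
qed

lemma support_subset_M: "sets \<mu> = sets m \<Longrightarrow> measure_support \<mu> \<subseteq> M"
  using sets_eq_imp_space_eq[of \<mu> m] by (auto simp: measure_support_def)

text \<open>A neighbourhood of a support point has positive measure, so an almost sure property
  cannot fail on all of it. This is the recurring passage from almost sure statements to given
  points.\<close>

lemma support_witness:
  assumes sets: "sets \<mu> = sets m" and x: "x \<in> measure_support \<mu>" and U: "open U" "x \<in> U"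
    and Q: "AE z in \<mu>. Q z"
  shows "\<exists>z\<in>U \<inter> M. Q z"
proof (rule ccontr)
  assume neg: "\<not> ?thesis"
  have sp: "space \<mu> = M" using sets_eq_imp_space_eq[OF sets] by simp
  from Q have "AE z in \<mu>. z \<notin> U \<inter> M" by eventually_elim (use neg in blast)
  then have "emeasure \<mu> (U \<inter> M) = 0"
    using open_Int_sets_m[OF U(1)] sets
    by (intro iffD1[OF AE_iff_measurable[of "U \<inter> M" \<mu> "\<lambda>z. z \<notin> U \<inter> M"]]) (auto simp: sp)
  then show False using x U by (auto simp: measure_support_def sp)
qed

lemma support_subset_closed:
  assumes "sets \<mu> = sets m" "closed F" "AE x in \<mu>. x \<in> F"
  shows "measure_support \<mu> \<subseteq> F"
  using support_witness[OF assms(1) _ _ _ assms(3), of _ "- F"] assms(2) by auto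

lemma closure_support:
  assumes "sets \<mu> = sets m"
  shows "closure (measure_support \<mu>) = measure_support \<mu>"
proof (intro equalityI subsetI)
  have sp: "space \<mu> = M" using sets_eq_imp_space_eq[OF assms] by simp
  fix x assume x: "x \<in> closure (measure_support \<mu>)"
  have xM: "x \<in> M"
    using x compact_M support_subset_M[OF assms] closure_minimal compact_imp_closed by blast
  have "emeasure \<mu> (U \<inter> space \<mu>) > 0" if "open U" "x \<in> U" for U
  proof -
    obtain y where "y \<in> U" "y \<in> measure_support \<mu>"
      using x \<open>open U\<close> \<open>x \<in> U\<close> closure_iff_nhds_not_empty[of x "measure_support \<mu>"] by blast
    then show ?thesis using that by (auto simp: measure_support_def)
  qed
  then show "x \<in> measure_support \<mu>" using xM by (auto simp: measure_support_def sp)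
qed (use closure_subset in auto)

section \<open>Invariant measures, ergodicity and chains between supports\<close>

lemma acimD:
  assumes "acim M T \<nu>"
  shows "prob_space \<nu>" "sets \<nu> = sets m" "space \<nu> = M" "distr \<nu> \<nu> T = \<nu>"
    "absolutely_continuous m \<nu>" "T \<in> \<nu> \<rightarrow>\<^sub>M \<nu>"
proof -
  show s: "prob_space \<nu>" "sets \<nu> = sets m" "distr \<nu> \<nu> T = \<nu>" "absolutely_continuous m \<nu>"
    using assms by (auto simp: acim_def)
  show "space \<nu> = M" using sets_eq_imp_space_eq[OF s(2)] by simp
  show "T \<in> \<nu> \<rightarrow>\<^sub>M \<nu>" using T_measurable s(2) measurable_cong_sets by blast
qed

lemma acim_vimage:
  assumes "acim M T \<nu>" "A \<in> sets m"
  shows "emeasure \<nu> (T -` A \<inter> M) = emeasure \<nu> A" "measure \<nu> (T -` A \<inter> M) = measure \<nu> A"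
proof -
  note \<nu> = acimD[OF assms(1)]
  show e: "emeasure \<nu> (T -` A \<inter> M) = emeasure \<nu> A"
    using emeasure_distr[OF \<nu>(6), of A] assms(2) \<nu> by simp
  then show "measure \<nu> (T -` A \<inter> M) = measure \<nu> A" by (simp add: measure_def)
qed

lemma acim_AE_T:
  assumes "acim M T \<nu>" "AE x in \<nu>. Q x"
  shows "AE x in \<nu>. Q (T x)"
  using AE_distrD[OF acimD(6)[OF assms(1)], of Q] assms(2) by (simp only: acimD(4)[OF assms(1)])

lemma acim_AE_funpow:
  assumes "acim M T \<nu>" "AE x in \<nu>. Q x"
  shows "AE x in \<nu>. Q ((T ^^ n) x)"
proof (induction n)
  case (Suc n)
  then show ?case using acim_AE_T[OF assms(1), of "\<lambda>x. Q ((T ^^ n) x)"] by (simp add: funpow_swap1)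
qed (use assms in simp)

lemma acim_vimage_funpow:
  assumes "acim M T \<nu>" "A \<in> sets m"
  shows "(T ^^ n) -` A \<inter> M \<in> sets m \<and> measure \<nu> ((T ^^ n) -` A \<inter> M) = measure \<nu> A"
proof (induction n)
  case 0
  then show ?case using assms(2) sets.sets_into_space[OF assms(2)] by (simp add: Int_absorb2)
next
  case (Suc n)
  have "(T ^^ Suc n) -` A \<inter> M = T -` ((T ^^ n) -` A \<inter> M) \<inter> M"
    using T_in_M by (auto simp: funpow_swap1)
  then show ?case
    using Suc acim_vimage(2)[OF assms(1), of "(T ^^ n) -` A \<inter> M"]
      measurable_sets[OF T_measurable, of "(T ^^ n) -` A \<inter> M"] by (simp only: space_m)
qed

text \<open>Ergodicity is defined through strictly invariant sets only. The points whose orbit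
  eventually stays in \<open>A\<close> form such a set, and it has the same measure as
  \<open>A\<close>.\<close>

lemma ergodic_forward_invariant:
  assumes erg: "ergodic_acim M T \<nu>" and A: "A \<in> sets m"
    and fwd: "AE x in \<nu>. x \<in> A \<longrightarrow> T x \<in> A"
  shows "measure \<nu> A \<in> {0, 1}"
proof -
  have \<nu>: "acim M T \<nu>" using erg by (simp add: ergodic_acim_def)
  interpret prob_space \<nu> by (rule acimD(1)[OF \<nu>])
  note sets_\<nu> = acimD(2)[OF \<nu>] and space_\<nu> = acimD(3)[OF \<nu>]
  define C where "C n = {x \<in> M. \<forall>k\<ge>n. (T ^^ k) x \<in> A}" for n
  have meas: "(T ^^ k) -` A \<inter> M \<in> sets m" for k
    using acim_vimage_funpow[OF \<nu> A] by blast
  have "C n = (\<Inter>k\<in>{n..}. (T ^^ k) -` A \<inter> M)" for n by (auto simp: C_def)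
  then have C_sets: "C n \<in> sets m" for n
    using meas by (simp only:) (intro sets.countable_INT', auto)
  have inc: "incseq C" by (auto simp: incseq_def C_def)
  have U_sets: "(\<Union>n. C n) \<in> sets m" using C_sets by auto
  have "T -` (\<Union>n. C n) \<inter> M = (\<Union>n. C n)"
  proof (intro equalityI subsetI)
    fix x assume "x \<in> T -` (\<Union>n. C n) \<inter> M"
    then obtain n where n: "x \<in> M" "\<forall>k\<ge>n. (T ^^ k) (T x) \<in> A" by (auto simp: C_def)
    have "(T ^^ k) x \<in> A" if "k \<ge> Suc n" for k
      using n(2)[rule_format, of "k - 1"] that by (cases k) (auto simp: funpow_swap1)
    then show "x \<in> (\<Union>n. C n)" using n(1) unfolding C_def by blast
  next
    fix x assume "x \<in> (\<Union>n. C n)"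
    then obtain n where n: "x \<in> M" "\<forall>k\<ge>n. (T ^^ k) x \<in> A" by (auto simp: C_def)
    have "(T ^^ k) (T x) \<in> A" if "k \<ge> n" for k
      using n(2)[rule_format, of "Suc k"] that by (auto simp: funpow_swap1)
    then show "x \<in> T -` (\<Union>n. C n) \<inter> M" using n(1) T_in_M by (auto simp: C_def)
  qed
  then have "measure \<nu> (\<Union>n. C n) \<in> {0, 1}"
    using erg U_sets by (auto simp: ergodic_acim_def)
  moreover have "measure \<nu> (\<Union>n. C n) = measure \<nu> A"
  proof (rule antisym)
    \<comment> \<open>\<open>C n\<close> lies in the preimage of \<open>A\<close> under the
      \<open>n\<close>-th iterate, which has the measure of \<open>A\<close>; the bound survives the
      increasing limit.\<close>
    have "measure \<nu> (C n) \<le> measure \<nu> A" for n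
    proof -
      have "measure \<nu> (C n) \<le> measure \<nu> ((T ^^ n) -` A \<inter> M)"
        using meas by (intro finite_measure_mono) (auto simp: C_def sets_\<nu>)
      then show ?thesis using acim_vimage_funpow[OF \<nu> A] by simp
    qed
    moreover have "(\<lambda>n. measure \<nu> (C n)) \<longlonglongrightarrow> measure \<nu> (\<Union>n. C n)"
      using inc C_sets by (intro finite_Lim_measure_incseq) (auto simp: sets_\<nu>)
    ultimately show "measure \<nu> (\<Union>n. C n) \<le> measure \<nu> A"
      by (intro LIMSEQ_le_const2) auto
  next
    \<comment> \<open>Conversely, invariance of \<open>\<nu>\<close> transports the almost sure
      hypothesis along whole orbits, so almost every point of \<open>A\<close> already lies in
      \<open>C 0\<close>.\<close>
    have "AE x in \<nu>. \<forall>k. (T ^^ k) x \<in> A \<longrightarrow> T ((T ^^ k) x) \<in> A"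
      unfolding AE_all_countable using acim_AE_funpow[OF \<nu> fwd] by simp
    then have "AE x in \<nu>. x \<in> A \<longrightarrow> x \<in> (\<Union>n. C n)"
    proof (eventually_elim, intro impI)
      fix x assume s: "\<forall>k. (T ^^ k) x \<in> A \<longrightarrow> T ((T ^^ k) x) \<in> A" and "x \<in> A"
      have "(T ^^ k) x \<in> A" for k by (induction k) (use s \<open>x \<in> A\<close> in auto)
      then show "x \<in> (\<Union>n. C n)"
        using \<open>x \<in> A\<close> sets.sets_into_space[OF A] by (auto simp: C_def)
    qed
    then show "measure \<nu> A \<le> measure \<nu> (\<Union>n. C n)"
      using U_sets by (intro finite_measure_mono_AE) (auto simp: sets_\<nu>)
  qed
  ultimately show ?thesis by simp
qed

text \<open>The points that never enter \<open>V\<close> form a forward invariant set, and its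
  complement contains \<open>V\<close>, so it cannot have measure 1.\<close>

lemma ergodic_AE_visits:
  assumes erg: "ergodic_acim M T \<nu>" and V: "V \<in> sets m" "measure \<nu> V > 0"
  shows "AE x in \<nu>. \<exists>n. (T ^^ n) x \<in> V"
proof -
  have \<nu>: "acim M T \<nu>" using erg by (simp add: ergodic_acim_def)
  interpret prob_space \<nu> by (rule acimD(1)[OF \<nu>])
  note sets_\<nu> = acimD(2)[OF \<nu>] and space_\<nu> = acimD(3)[OF \<nu>]
  define W where "W = (\<Union>n. (T ^^ n) -` V \<inter> M)"
  have W: "W \<in> sets m"
    using acim_vimage_funpow[OF \<nu> V(1)] unfolding W_def by (intro sets.countable_UN) blast
  have "V \<subseteq> W"
    using sets.sets_into_space[OF V(1)] by (auto simp: W_def intro!: exI[of _ 0])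
  then have "measure \<nu> W > 0"
    using V finite_measure_mono[of V W] W by (simp add: sets_\<nu>)
  moreover have "x \<in> M - W \<Longrightarrow> T x \<in> M - W" for x
  proof -
    assume x: "x \<in> M - W"
    have "(T ^^ n) (T x) \<notin> V" for n
    proof
      assume "(T ^^ n) (T x) \<in> V"
      then have "(T ^^ Suc n) x \<in> V" by (simp add: funpow_swap1)
      then have "x \<in> W" using x unfolding W_def by blast
      then show False using x by blast
    qed
    then show "T x \<in> M - W" using x T_in_M by (auto simp: W_def)
  qed
  then have "measure \<nu> (M - W) \<in> {0, 1}"
    using W sets.compl_sets[of W m] by (intro ergodic_forward_invariant[OF erg]) auto
  ultimately have "measure \<nu> W = 1" using prob_compl[of W] W by (auto simp: sets_\<nu> space_\<nu>)
  then have "AE x in \<nu>. x \<in> W" using prob_eq_1[of W] W by (simp add: sets_\<nu>)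
  then show ?thesis by eventually_elim (auto simp: W_def)
qed

text \<open>By invariance the preimage of a neighbourhood of \<open>x\<close> has the same positive
  measure as the neighbourhood. This moves backwards along \<open>T\<close>, whereas the image
  \<open>T x\<close> of a support point is not under control.\<close>

lemma support_preimage_witness:
  assumes \<nu>: "acim M T \<nu>" and x: "x \<in> measure_support \<nu>" and U: "open U" "x \<in> U"
    and Q: "AE z in \<nu>. Q z"
  shows "\<exists>z\<in>M. Q z \<and> T z \<in> U"
proof (rule ccontr)
  assume neg: "\<not> ?thesis"
  note s = acimD[OF \<nu>]
  have "AE z in \<nu>. z \<in> space \<nu>" by auto
  with Q have "AE z in \<nu>. z \<notin> T -` (U \<inter> M) \<inter> M" by eventually_elim (use neg in auto)
  moreover have "T -` (U \<inter> M) \<inter> M \<in> sets \<nu>"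
    using measurable_sets[OF T_measurable open_Int_sets_m[OF U(1)]] s by simp
  ultimately have "emeasure \<nu> (T -` (U \<inter> M) \<inter> M) = 0"
    using s(3)
    by (intro iffD1[OF AE_iff_measurable[of "T -` (U \<inter> M) \<inter> M" \<nu> "\<lambda>z. z \<notin> T -` (U \<inter> M) \<inter> M"]]) auto
  then have "emeasure \<nu> (U \<inter> M) = 0"
    using acim_vimage[OF \<nu> open_Int_sets_m[OF U(1)]] by simp
  then show False using x U s by (auto simp: measure_support_def)
qed

lemma support_nonempty:
  assumes "acim M T \<nu>"
  shows "measure_support \<nu> \<noteq> {}"
proof -
  interpret prob_space \<nu> by (rule acimD(1)[OF assms])
  show ?thesis using AE_support[OF acimD(2)[OF assms]] AE_False by force
qed

lemma ergodic_supportsE: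
  assumes "\<Lambda> \<in> ergodic_supports M T"
  obtains \<nu> where "\<Lambda> = measure_support \<nu>" "ergodic_acim M T \<nu>" "acim M T \<nu>" "sets \<nu> = sets m"
  using assms acimD(2) by (auto simp: ergodic_supports_def ergodic_acim_def)

lemma ergodic_support_subset_M: "\<Lambda> \<in> ergodic_supports M T \<Longrightarrow> \<Lambda> \<subseteq> M"
  by (metis ergodic_supportsE support_subset_M)

lemma ergodic_support_nonempty: "\<Lambda> \<in> ergodic_supports M T \<Longrightarrow> \<Lambda> \<noteq> {}"
  by (metis ergodic_supportsE support_nonempty)

text \<open>Generic points lie in the support, and some of them are mapped arbitrarily close to
  \<open>x\<close>. A chain starting in a support can thus always be lengthened at its
  beginning.\<close>

lemma ergodic_support_predecessor:
  assumes "\<Lambda> \<in> ergodic_supports M T" "x \<in> \<Lambda>" "e > 0"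
  shows "\<exists>z\<in>\<Lambda>. eps_step M T e z x"
proof -
  obtain \<nu> where \<nu>: "\<Lambda> = measure_support \<nu>" "acim M T \<nu>" "sets \<nu> = sets m"
    using ergodic_supportsE[OF assms(1)] by metis
  obtain z where "z \<in> M" "z \<in> measure_support \<nu>" "T z \<in> ball x e"
    using support_preimage_witness[OF \<nu>(2) _ _ _ AE_support[OF \<nu>(3)], of x "ball x e"] assms \<nu>(1)
    by auto
  then show ?thesis
    using assms \<nu>(1) ergodic_support_subset_M[OF assms(1)]
    by (intro bexI[of _ z]) (auto simp: eps_step_def dist_commute)
qed

text \<open>
  The points of a support are only generic up to a null set, and \<open>T\<close> may map the others away from
  it. Both ends of a pseudo-orbit can nevertheless be moved to generic points, which
  visit every set of positive measure.
\<close>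

lemma tranclp_eps_step_connect:
  assumes \<Lambda>: "\<Lambda> \<in> ergodic_supports M T" and y: "y \<in> \<Lambda>" and z: "z \<in> \<Lambda>"
    and xy: "(eps_step M T e)\<^sup>+\<^sup>+ x y" and e: "e > 0"
  shows "(eps_step M T e)\<^sup>+\<^sup>+ x z"
proof -
  obtain \<nu> where \<nu>: "\<Lambda> = measure_support \<nu>" "ergodic_acim M T \<nu>" "acim M T \<nu>" "sets \<nu> = sets m"
    using ergodic_supportsE[OF \<Lambda>] by metis
  have zM: "z \<in> M" using z ergodic_support_subset_M[OF \<Lambda>] by blast
  obtain x' where x': "(eps_step M T e)\<^sup>*\<^sup>* x x'" "eps_step M T e x' y"
    using xy by (metis tranclpD tranclp.cases r_into_rtranclp rtranclp.rtrancl_refl tranclp_into_rtranclp)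
  define V where "V = T -` (ball z e \<inter> M) \<inter> M"
  have oz: "ball z e \<inter> M \<in> sets m" by (intro open_Int_sets_m) auto
  have V: "V \<in> sets m" using measurable_sets[OF T_measurable oz] by (simp add: V_def)
  have "emeasure \<nu> V > 0"
    using acim_vimage(1)[OF \<nu>(3) oz] z \<nu>(1) e acimD(3)[OF \<nu>(3)]
    by (auto simp: V_def measure_support_def)
  then have "measure \<nu> V > 0"
    using prob_space.axioms(1)[OF acimD(1)[OF \<nu>(3)], THEN finite_measure.emeasure_eq_measure]
    by simp
  \<comment> \<open>\<open>ball (T x') e\<close> is a neighbourhood of \<open>y\<close>, so the last
    step may end at a generic \<open>w\<close> instead; the orbit of \<open>w\<close> enters
    \<open>V\<close>, and from \<open>V\<close> one step leads to \<open>z\<close>.\<close>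
  from support_witness[OF \<nu>(4) _ _ _ ergodic_AE_visits[OF \<nu>(2) V this], of y "ball (T x') e"]
  obtain w n where w: "w \<in> M" "dist (T x') w < e" "(T ^^ n) w \<in> V"
    using y x' \<nu>(1) by (auto simp: eps_step_def)
  have "(eps_step M T e)\<^sup>*\<^sup>* w ((T ^^ k) w)" for k
  proof (induction k)
    case (Suc k)
    moreover have "eps_step M T e ((T ^^ k) w) ((T ^^ Suc k) w)"
      using e w(1) funpow_T_in_M[of w] T_in_M by (simp add: eps_step_def)
    ultimately show ?case by (rule rtranclp.rtrancl_into_rtrancl)
  qed simp
  moreover have "eps_step M T e ((T ^^ n) w) z"
    using w zM by (auto simp: V_def eps_step_def dist_commute)
  moreover have "eps_step M T e x' w" using x' w by (auto simp: eps_step_def)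
  ultimately show ?thesis using x'(1) by (meson rtranclp_into_tranclp1 rtranclp.rtrancl_into_rtrancl rtranclp_trans)
qed

text \<open>A pseudo-orbit of length zero has no last step to perturb; prepending a predecessor
  inside \<open>\<Lambda>\<close> cures this.\<close>

lemma leads_to_tranclp:
  assumes "\<Lambda> \<in> ergodic_supports M T" "leads_to M T \<Lambda> A" "e > 0"
  shows "\<exists>x\<in>\<Lambda>. \<exists>y\<in>A. (eps_step M T e)\<^sup>+\<^sup>+ x y"
proof -
  obtain x y where xy: "x \<in> \<Lambda>" "y \<in> A" "(eps_step M T e)\<^sup>*\<^sup>* x y"
    using assms by (auto simp: leads_to_iff_rtranclp)
  obtain z where "z \<in> \<Lambda>" "eps_step M T e z x"
    using ergodic_support_predecessor[OF assms(1) xy(1) assms(3)] by blast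
  then show ?thesis using xy rtranclp_into_tranclp2 by metis
qed

lemma leads_to_refl: "\<Lambda> \<in> ergodic_supports M T \<Longrightarrow> leads_to M T \<Lambda> \<Lambda>"
  using ergodic_support_nonempty ergodic_support_subset_M unfolding leads_to_iff_rtranclp by blast

text \<open>The first chain ends and the second begins at possibly different points of the middle
  support; \<open>tranclp_eps_step_connect\<close> redirects the end of the first to the start of
  the second.\<close>

lemma leads_to_trans:
  assumes \<Lambda>: "\<Lambda>\<^sub>1 \<in> ergodic_supports M T" "\<Lambda>\<^sub>2 \<in> ergodic_supports M T"
    and lt: "leads_to M T \<Lambda>\<^sub>1 \<Lambda>\<^sub>2" "leads_to M T \<Lambda>\<^sub>2 \<Lambda>\<^sub>3"
  shows "leads_to M T \<Lambda>\<^sub>1 \<Lambda>\<^sub>3"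
  unfolding leads_to_iff_rtranclp
proof (intro allI impI)
  fix e :: real assume e: "e > 0"
  obtain x y where xy: "x \<in> \<Lambda>\<^sub>1" "y \<in> \<Lambda>\<^sub>2" "(eps_step M T e)\<^sup>+\<^sup>+ x y"
    using leads_to_tranclp[OF \<Lambda>(1) lt(1) e] by blast
  obtain y' z where yz: "y' \<in> \<Lambda>\<^sub>2" "z \<in> \<Lambda>\<^sub>3" "(eps_step M T e)\<^sup>*\<^sup>* y' z"
    using lt(2) e by (auto simp: leads_to_iff_rtranclp)
  have "(eps_step M T e)\<^sup>+\<^sup>+ x y'"
    by (rule tranclp_eps_step_connect[OF \<Lambda>(2) xy(2) yz(1) xy(3) e])
  then have "(eps_step M T e)\<^sup>*\<^sup>* x z" using yz(3) by (meson tranclp_into_rtranclp rtranclp_trans)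
  then show "\<exists>x\<in>\<Lambda>\<^sub>1 \<inter> M. \<exists>y\<in>\<Lambda>\<^sub>3. (eps_step M T e)\<^sup>*\<^sup>* x y"
    using xy yz ergodic_support_subset_M[OF \<Lambda>(1)] by blast
qed

subsection \<open>Invariant densities\<close>

text \<open>The fixed point equation of the transfer operator in weak form, independent of the
  version picked by \<open>transfer_op\<close>. There is no sign condition: the limits of averages
  constructed below may change sign.\<close>

definition inv_density :: "('a \<Rightarrow> real) \<Rightarrow> bool" where
  "inv_density w \<longleftrightarrow> w \<in> L1 M \<and>
     (\<forall>g\<in>Linf M. (LINT x|m. w x * g (T x)) = (LINT x|m. w x * g x))"

lemma L1_integrable: "f \<in> L1 M \<longleftrightarrow> integrable m f"
  by (simp add: L1_def)

lemma Linf_bound: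
  assumes "g \<in> Linf M"
  obtains C where "C \<ge> 0" "AE x in m. \<bar>g x\<bar> \<le> C"
proof -
  obtain C where C: "AE x in m. \<bar>g x\<bar> \<le> C" using assms by (auto simp: Linf_def)
  from C have "AE x in m. \<bar>g x\<bar> \<le> \<bar>C\<bar>" by eventually_elim auto
  then show ?thesis using that[of "\<bar>C\<bar>"] by simp
qed

lemma Linf_I: "g \<in> borel_measurable m \<Longrightarrow> (\<And>x. x \<in> M \<Longrightarrow> \<bar>g x\<bar> \<le> C) \<Longrightarrow> g \<in> Linf M"
  unfolding Linf_def by (auto intro!: exI[of _ C] AE_I2)

lemma indicator_Linf: "A \<in> sets m \<Longrightarrow> indicator A \<in> Linf M"
  by (intro Linf_I[of _ 1]) (auto simp: indicator_def)

text \<open>Non-singularity makes the preimage of the exceptional null set null again.\<close>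

lemma Linf_comp_T:
  assumes "g \<in> Linf M"
  shows "(\<lambda>x. g (T x)) \<in> Linf M"
proof -
  obtain C where C: "AE x in m. \<bar>g x\<bar> \<le> C" using assms by (auto simp: Linf_def)
  have [measurable]: "g \<in> borel_measurable m" using assms by (simp add: Linf_def)
  have "AE x in distr m m T. \<bar>g x\<bar> \<le> C"
    by (rule absolutely_continuous_AE[OF _ T_nonsingular C]) simp
  then have "AE x in m. \<bar>g (T x)\<bar> \<le> C" by (rule AE_distrD[OF T_measurable])
  then show ?thesis unfolding Linf_def by auto
qed

lemma integrable_mult_Linf:
  assumes "f \<in> L1 M" "g \<in> Linf M"
  shows "integrable m (\<lambda>x. f x * g x)"
proof -
  have [measurable]: "g \<in> borel_measurable m" using assms by (simp add: Linf_def)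
  have f: "integrable m f" using assms by (simp add: L1_integrable)
  then have [measurable]: "f \<in> borel_measurable m" by simp
  obtain C where C: "C \<ge> 0" "AE x in m. \<bar>g x\<bar> \<le> C" using Linf_bound[OF assms(2)] by blast
  show ?thesis
  proof (rule Bochner_Integration.integrable_bound[of _ "\<lambda>x. C * f x"])
    show "AE x in m. norm (f x * g x) \<le> norm (C * f x)"
      using C(2)
    proof eventually_elim
      fix x assume "\<bar>g x\<bar> \<le> C"
      then have "\<bar>f x\<bar> * \<bar>g x\<bar> \<le> \<bar>f x\<bar> * C" by (intro mult_left_mono) auto
      then show "norm (f x * g x) \<le> norm (C * f x)" using C(1) by (simp add: abs_mult mult.commute)
    qed
  qed (use f in auto)
qed

lemma abs_integral_mult_le:
  assumes "f \<in> L1 M" "g \<in> Linf M" and C: "AE x in m. \<bar>g x\<bar> \<le> C"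
  shows "\<bar>LINT x|m. f x * g x\<bar> \<le> C * L1_norm M f"
proof -
  have f: "integrable m f" using assms by (simp add: L1_integrable)
  have "\<bar>LINT x|m. f x * g x\<bar> \<le> (LINT x|m. \<bar>f x * g x\<bar>)" by (rule integral_abs_bound)
  also have "\<dots> \<le> (LINT x|m. C * \<bar>f x\<bar>)"
  proof (rule integral_mono_AE)
    show "AE x in m. \<bar>f x * g x\<bar> \<le> C * \<bar>f x\<bar>"
      using C by eventually_elim (simp add: abs_mult mult.commute[of C] mult_left_mono)
  qed (use f integrable_mult_Linf[OF assms(1,2)] in auto)
  finally show ?thesis by (simp add: L1_norm_def)
qed

lemma L1_norm_triangle:
  assumes "f \<in> L1 M" "g \<in> L1 M" "h \<in> L1 M"
  shows "L1_norm M (\<lambda>x. f x - h x) \<le> L1_norm M (\<lambda>x. f x - g x) + L1_norm M (\<lambda>x. g x - h x)"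
proof -
  have i: "integrable m f" "integrable m g" "integrable m h" using assms by (auto simp: L1_integrable)
  have "(LINT x|m. \<bar>f x - h x\<bar>) \<le> (LINT x|m. \<bar>f x - g x\<bar> + \<bar>g x - h x\<bar>)"
    using i by (intro integral_mono) auto
  also have "\<dots> = (LINT x|m. \<bar>f x - g x\<bar>) + (LINT x|m. \<bar>g x - h x\<bar>)"
    using i by (intro Bochner_Integration.integral_add) auto
  finally show ?thesis by (simp add: L1_norm_def)
qed

lemma L1_norm_commute: "L1_norm M (\<lambda>x. f x - g x) = L1_norm M (\<lambda>x. g x - f x)"
  unfolding L1_norm_def by (simp add: abs_minus_commute)

lemma L1_diff: "f \<in> L1 M \<Longrightarrow> g \<in> L1 M \<Longrightarrow> (\<lambda>x. f x - g x) \<in> L1 M"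
  by (simp add: L1_integrable)

section \<open>The transfer operator: existence, duality and contraction\<close>

lemma emeasure_density_M:
  "f \<in> borel_measurable m \<Longrightarrow> emeasure (density m f) M = (\<integral>\<^sup>+x. f x \<partial>m)"
  using sets.top[of m] by (subst emeasure_density) (auto intro!: nn_integral_cong)

lemma transfer_op_exists_nonneg:
  assumes f: "f \<in> L1 M" and nn: "\<And>x. 0 \<le> f x"
  shows "\<exists>h\<in>L1 M. \<forall>g\<in>borel_measurable m. (LINT x|m. f x * g (T x)) = (LINT x|m. h x * g x)"
proof -
  have fi: "integrable m f" using f by (simp add: L1_integrable)
  then have [measurable]: "f \<in> borel_measurable m" by simp
  define N where "N = distr (density m (\<lambda>x. ennreal (f x))) m T"
  have [measurable]: "T \<in> density m (\<lambda>x. ennreal (f x)) \<rightarrow>\<^sub>M m" by simp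
  have "T -` M \<inter> M = M" using T_in_M by auto
  then have "emeasure N (space N) = (\<integral>\<^sup>+x. ennreal (f x) \<partial>m)"
    using sets.top[of m] by (simp add: N_def emeasure_distr emeasure_density_M)
  also have "\<dots> < \<infinity>" using fi nn by (simp add: nn_integral_eq_integral)
  finally have N_fin: "emeasure N (space N) < \<infinity>" .
  then interpret N: finite_measure N by (intro finite_measureI) auto
  have sN: "sets N = sets m" by (simp add: N_def)
  have ac: "absolutely_continuous m N"
    unfolding absolutely_continuous_def
  proof
    fix A assume A: "A \<in> null_sets m"
    then have "A \<in> null_sets (distr m m T)" using T_nonsingular by (auto simp: absolutely_continuous_def)
    then have "T -` A \<inter> M \<in> null_sets m"
      using A measurable_sets[OF T_measurable, of A] by (auto simp: null_sets_def emeasure_distr)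
    then have "T -` A \<inter> M \<in> null_sets (density m (\<lambda>x. ennreal (f x)))"
      using absolutely_continuousI_density[of "\<lambda>x. ennreal (f x)" m] by (auto simp: absolutely_continuous_def)
    then show "A \<in> null_sets N" using A by (auto simp: N_def null_sets_def emeasure_distr)
  qed
  obtain h where h: "h \<in> borel_measurable m" "AE x in m. RN_deriv m N x = ennreal (h x)" "\<And>x. 0 \<le> h x"
    using m.real_RN_deriv[OF N.finite_measure_axioms ac sN] by metis
  have "density m (\<lambda>x. ennreal (h x)) = density m (RN_deriv m N)"
    using h by (intro density_cong) auto
  then have hN: "density m (\<lambda>x. ennreal (h x)) = N"
    using m.density_RN_deriv[OF ac sN] by simp
  have "(\<integral>\<^sup>+x. ennreal (h x) \<partial>m) = emeasure N (space N)"
    using h(1) unfolding hN[symmetric] by (simp add: emeasure_density_M)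
  then have "integrable m h" using N_fin h by (intro integrableI_nonneg) auto
  then have hL: "h \<in> L1 M" by (simp add: L1_integrable)
  moreover have "(LINT x|m. f x * g (T x)) = (LINT x|m. h x * g x)" if [measurable]: "g \<in> borel_measurable m" for g
  proof -
    have "(LINT x|m. h x * g x) = integral\<^sup>L N g"
      using h unfolding hN[symmetric] by (subst integral_density) auto
    also have "\<dots> = (LINT x|density m (\<lambda>x. ennreal (f x)). g (T x))"
      unfolding N_def by (rule integral_distr) auto
    also have "\<dots> = (LINT x|m. f x * g (T x))"
      using nn by (subst integral_density) auto
    finally show ?thesis by simp
  qed
  ultimately show ?thesis by blast
qed

text \<open>Positive and negative parts of \<open>f\<close> are treated separately, which yields the
  witness behind the choice in \<open>transfer_op\<close>; bounded \<open>g\<close> keeps the two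
  integrals finite, so they may be subtracted.\<close>

lemma transfer_op_spec:
  assumes f: "f \<in> L1 M"
  shows "transfer_op M T f \<in> L1 M"
    and "g \<in> Linf M \<Longrightarrow> (LINT x|m. f x * g (T x)) = (LINT x|m. transfer_op M T f x * g x)"
proof -
  define fp where "fp x = max 0 (f x)" for x
  define fn where "fn x = max 0 (- f x)" for x
  have fpn: "fp \<in> L1 M" "fn \<in> L1 M" using f by (auto simp: L1_integrable fp_def[abs_def] fn_def[abs_def])
  obtain hp where hp: "hp \<in> L1 M" "\<And>g. g \<in> borel_measurable m \<Longrightarrow> (LINT x|m. fp x * g (T x)) = (LINT x|m. hp x * g x)"
    using transfer_op_exists_nonneg[OF fpn(1)] by (auto simp: fp_def)
  obtain hn where hn: "hn \<in> L1 M" "\<And>g. g \<in> borel_measurable m \<Longrightarrow> (LINT x|m. fn x * g (T x)) = (LINT x|m. hn x * g x)"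
    using transfer_op_exists_nonneg[OF fpn(2)] by (auto simp: fn_def)
  have "(LINT x|m. f x * g (T x)) = (LINT x|m. (hp x - hn x) * g x)" if g: "g \<in> Linf M" for g
  proof -
    have gm: "g \<in> borel_measurable m" using g by (simp add: Linf_def)
    have "f x = fp x - fn x" for x by (simp add: fp_def fn_def max_def)
    then have "(LINT x|m. f x * g (T x)) = (LINT x|m. fp x * g (T x) - fn x * g (T x))"
      by (simp add: left_diff_distrib)
    also have "\<dots> = (LINT x|m. fp x * g (T x)) - (LINT x|m. fn x * g (T x))"
      by (intro Bochner_Integration.integral_diff integrable_mult_Linf[OF _ Linf_comp_T[OF g]] fpn)
    also have "\<dots> = (LINT x|m. hp x * g x) - (LINT x|m. hn x * g x)" using hp hn gm by simp
    also have "\<dots> = (LINT x|m. hp x * g x - hn x * g x)"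
      by (intro Bochner_Integration.integral_diff[symmetric] integrable_mult_Linf g hp hn)
    finally show ?thesis by (simp add: left_diff_distrib)
  qed
  then have "\<exists>h. h \<in> L1 M \<and> (\<forall>g\<^sub>2\<in>Linf M. (LINT x|m. f x * g\<^sub>2 (T x)) = (LINT x|m. h x * g\<^sub>2 x))"
    using L1_diff[OF hp(1) hn(1)] by (intro exI[of _ "\<lambda>x. hp x - hn x"]) auto
  from someI_ex[OF this] show "transfer_op M T f \<in> L1 M"
    "g \<in> Linf M \<Longrightarrow> (LINT x|m. f x * g (T x)) = (LINT x|m. transfer_op M T f x * g x)"
    unfolding transfer_op_def by blast+
qed

lemma inv_density_0: "inv_density (\<lambda>x. 0)"
  by (simp add: inv_density_def L1_integrable)

text \<open>Duality with the sign \<open>s\<close> of the difference: the integral of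
  \<open>(h - w) * s\<close> equals that of \<open>(f - w) * (s \<circ> T)\<close>, and
  \<open>s \<circ> T\<close> is still bounded by 1. As \<open>w\<close> is fixed, iteration never
  moves away from it; \<open>w = 0\<close> gives the bound on the norm of the image.\<close>

lemma transfer_op_contracts:
  assumes f: "f \<in> L1 M" and w: "inv_density w"
  shows "L1_norm M (\<lambda>x. transfer_op M T f x - w x) \<le> L1_norm M (\<lambda>x. f x - w x)"
proof -
  define h where "h = transfer_op M T f"
  have h: "h \<in> L1 M" using transfer_op_spec[OF f] by (simp add: h_def)
  have wL: "w \<in> L1 M" using w by (simp add: inv_density_def)
  have [measurable]: "h \<in> borel_measurable m" "w \<in> borel_measurable m" using h wL by (auto simp: L1_integrable)
  define s :: "'a \<Rightarrow> real" where "s x = (if w x \<le> h x then 1 else -1)" for x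
  have s: "s \<in> Linf M" by (intro Linf_I[of _ 1]) (auto simp: s_def[abs_def])
  have sT: "AE x in m. \<bar>s (T x)\<bar> \<le> 1" by (auto simp: s_def)
  have "L1_norm M (\<lambda>x. h x - w x) = (LINT x|m. h x * s x - w x * s x)"
    unfolding L1_norm_def s_def by (intro Bochner_Integration.integral_cong) auto
  also have "\<dots> = (LINT x|m. h x * s x) - (LINT x|m. w x * s x)"
    by (intro Bochner_Integration.integral_diff integrable_mult_Linf h wL s)
  also have "\<dots> = (LINT x|m. f x * s (T x)) - (LINT x|m. w x * s (T x))"
    using transfer_op_spec(2)[OF f s] w s by (simp add: inv_density_def h_def)
  also have "\<dots> = (LINT x|m. f x * s (T x) - w x * s (T x))"
    by (intro Bochner_Integration.integral_diff[symmetric] integrable_mult_Linf f wL Linf_comp_T s)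
  also have "\<dots> = (LINT x|m. (f x - w x) * s (T x))" by (simp add: left_diff_distrib)
  also have "\<dots> \<le> 1 * L1_norm M (\<lambda>x. f x - w x)"
    using abs_integral_mult_le[OF L1_diff[OF f wL] Linf_comp_T[OF s] sT] by linarith
  finally show ?thesis by (simp add: h_def)
qed

lemma funpow_transfer_op_L1: "f \<in> L1 M \<Longrightarrow> (transfer_op M T ^^ n) f \<in> L1 M"
  by (induction n) (auto intro: transfer_op_spec)

lemma funpow_transfer_op_contracts:
  assumes "f \<in> L1 M" "inv_density w"
  shows "L1_norm M (\<lambda>x. (transfer_op M T ^^ n) f x - w x) \<le> L1_norm M (\<lambda>x. f x - w x)"
proof (induction n)
  case (Suc n)
  then show ?case
    using transfer_op_contracts[OF funpow_transfer_op_L1[OF assms(1), of n] assms(2)] by simp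
qed simp

lemma acim_density:
  assumes "acim M T \<nu>"
  obtains w where "inv_density w" "\<And>x. 0 \<le> w x" "\<nu> = density m (\<lambda>x. ennreal (w x))"
    "\<And>A. A \<in> sets m \<Longrightarrow> measure \<nu> A = (LINT x|m. w x * indicator A x)"
proof -
  note \<nu> = acimD[OF assms]
  interpret \<nu>: prob_space \<nu> by (rule \<nu>)
  obtain w where w[measurable]: "w \<in> borel_measurable m" and
    wRN: "AE x in m. RN_deriv m \<nu> x = ennreal (w x)" and nn: "\<And>x. 0 \<le> w x"
    using m.real_RN_deriv[OF \<nu>.finite_measure_axioms \<nu>(5,2)] by metis
  have "density m (\<lambda>x. ennreal (w x)) = density m (RN_deriv m \<nu>)"
    using wRN by (intro density_cong) auto
  then have w\<nu>: "\<nu> = density m (\<lambda>x. ennreal (w x))"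
    using m.density_RN_deriv[OF \<nu>(5,2)] by simp
  have int: "(LINT x|m. w x * g x) = integral\<^sup>L \<nu> g" if [measurable]: "g \<in> borel_measurable m" for g
    using nn unfolding w\<nu> by (subst integral_density) auto
  have "(\<integral>\<^sup>+x. ennreal (w x) \<partial>m) = emeasure \<nu> (space \<nu>)"
    unfolding w\<nu> by (simp add: emeasure_density_M)
  then have wi: "integrable m w" using \<nu>.emeasure_space_1 nn by (intro integrableI_nonneg) auto
  have inv: "(LINT x|m. w x * g (T x)) = (LINT x|m. w x * g x)" if "g \<in> Linf M" for g
  proof -
    have g[measurable]: "g \<in> borel_measurable m" using that by (simp add: Linf_def)
    then have g': "g \<in> borel_measurable \<nu>" using \<nu>(2) measurable_cong_sets by blast
    have "integral\<^sup>L \<nu> g = integral\<^sup>L (distr \<nu> \<nu> T) g" using \<nu>(4) by simp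
    also have "\<dots> = (LINT x|\<nu>. g (T x))" by (rule integral_distr[OF \<nu>(6) g'])
    finally show ?thesis by (simp add: int)
  qed
  show ?thesis
  proof
    show "inv_density w" using wi inv by (auto simp: inv_density_def L1_integrable)
    fix A assume A[measurable]: "A \<in> sets m"
    show "measure \<nu> A = (LINT x|m. w x * indicator A x)" using A \<nu>(2) by (subst int) auto
  qed (use w\<nu> nn in auto)
qed

text \<open>\<open>I\<close> is contained in its preimage, and both have the same finite measure, so
  they differ by a null set. Forward invariance therefore suffices for conditioning on
  \<open>I\<close> to preserve invariance.\<close>

lemma acim_uniform_measure:
  assumes fin: "finite_measure \<mu>" and sets: "sets \<mu> = sets m" and ac: "absolutely_continuous m \<mu>"
    and inv: "\<And>A. A \<in> sets m \<Longrightarrow> measure \<mu> (T -` A \<inter> M) = measure \<mu> A"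
    and I: "I \<in> sets m" "\<And>x. x \<in> I \<Longrightarrow> T x \<in> I" "measure \<mu> I > 0"
  shows "acim M T (uniform_measure \<mu> I)"
proof -
  interpret finite_measure \<mu> by (rule fin)
  have sp: "space \<mu> = M" using sets_eq_imp_space_eq[OF sets] by simp
  have emI: "emeasure \<mu> I \<noteq> 0" "emeasure \<mu> I \<noteq> \<infinity>" using I(3) by (auto simp: emeasure_eq_measure)
  have prob: "prob_space (uniform_measure \<mu> I)" by (rule prob_space_uniform_measure[OF emI])
  have su: "sets (uniform_measure \<mu> I) = sets m" by (simp add: sets)
  have spu: "space (uniform_measure \<mu> I) = M" by (simp add: sp)
  have Tm: "T \<in> uniform_measure \<mu> I \<rightarrow>\<^sub>M uniform_measure \<mu> I"
    using T_measurable su measurable_cong_sets by blast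
  have IM: "I \<subseteq> M" using sets.sets_into_space[OF I(1)] by simp
  have I_meas: "I \<in> sets \<mu>" using I by (simp add: sets)
  have preI: "T -` I \<inter> M \<in> sets \<mu>" using measurable_sets[OF T_measurable I(1)] by (simp add: sets)
  have "I \<subseteq> T -` I \<inter> M" using I(2) IM by auto
  then have "measure \<mu> ((T -` I \<inter> M) - I) = 0"
    using finite_measure_Diff[OF preI I_meas] inv[OF I(1)] by simp
  then have null: "(T -` I \<inter> M) - I \<in> null_sets \<mu>"
    using preI I_meas by (auto simp: null_sets_def emeasure_eq_measure)
  have eq: "measure \<mu> (I \<inter> (T -` A \<inter> M)) = measure \<mu> (I \<inter> A)" if A: "A \<in> sets m" for A
  proof -
    have TA: "T -` A \<inter> M \<in> sets \<mu>" using measurable_sets[OF T_measurable A] by (simp add: sets)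
    have "AE x in \<mu>. x \<in> I \<inter> (T -` A \<inter> M) \<longleftrightarrow> x \<in> T -` (I \<inter> A) \<inter> M"
      using AE_not_in[OF null] by eventually_elim (use I(2) IM in auto)
    then have "measure \<mu> (I \<inter> (T -` A \<inter> M)) = measure \<mu> (T -` (I \<inter> A) \<inter> M)"
      using I_meas TA measurable_sets[OF T_measurable, of "I \<inter> A"] I(1) A
      by (intro measure_eq_AE) (auto simp: sets)
    then show ?thesis using inv[of "I \<inter> A"] A I(1) by simp
  qed
  have "distr (uniform_measure \<mu> I) (uniform_measure \<mu> I) T = uniform_measure \<mu> I"
  proof (rule measure_eqI)
    fix A assume "A \<in> sets (distr (uniform_measure \<mu> I) (uniform_measure \<mu> I) T)"
    then have A: "A \<in> sets m" by (simp add: sets)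
    have TA: "T -` A \<inter> M \<in> sets \<mu>" using measurable_sets[OF T_measurable A] by (simp add: sets)
    have "emeasure (distr (uniform_measure \<mu> I) (uniform_measure \<mu> I) T) A
        = emeasure (uniform_measure \<mu> I) (T -` A \<inter> M)"
      using A Tm by (subst emeasure_distr) (auto simp: sets sp)
    also have "\<dots> = emeasure \<mu> (I \<inter> (T -` A \<inter> M)) / emeasure \<mu> I"
      by (rule emeasure_uniform_measure[OF I_meas TA])
    also have "\<dots> = emeasure \<mu> (I \<inter> A) / emeasure \<mu> I"
      using eq[OF A] by (simp only: emeasure_eq_measure)
    also have "\<dots> = emeasure (uniform_measure \<mu> I) A"
      using A by (intro emeasure_uniform_measure[symmetric] I_meas) (simp add: sets)
    finally show "emeasure (distr (uniform_measure \<mu> I) (uniform_measure \<mu> I) T) A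
        = emeasure (uniform_measure \<mu> I) A" .
  qed simp
  moreover have "absolutely_continuous m (uniform_measure \<mu> I)"
    unfolding absolutely_continuous_def
  proof
    fix A assume "A \<in> null_sets m"
    then have A: "A \<in> null_sets \<mu>" using ac by (auto simp: absolutely_continuous_def)
    then have "emeasure \<mu> (I \<inter> A) = 0" using I_meas by (metis null_setsD1 null_set_Int1)
    then show "A \<in> null_sets (uniform_measure \<mu> I)"
      using A I_meas by (auto simp: null_sets_def)
  qed
  ultimately show ?thesis using prob su by (simp add: acim_def)
qed

text \<open>The positive part of an invariant signed density is itself invariant; it charges
  \<open>I\<close> at least as much as \<open>w\<close> does and is then conditioned on
  \<open>I\<close>.\<close>

lemma acim_from_signed_density:
  assumes w: "inv_density w" and I: "I \<in> sets m" "\<And>x. x \<in> I \<Longrightarrow> T x \<in> I"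
    and pos: "(LINT x|m. w x * indicator I x) > 0"
  shows "\<exists>\<nu>. acim M T \<nu> \<and> (AE x in \<nu>. x \<in> I)"
proof -
  have wL: "w \<in> L1 M" and wi: "integrable m w" using w by (auto simp: inv_density_def L1_integrable)
  then have [measurable]: "w \<in> borel_measurable m" by auto
  define u where "u x = max 0 (w x)" for x
  have uL: "u \<in> L1 M" using wi by (simp add: L1_integrable u_def[abs_def])
  have u_nn: "0 \<le> u x" and w_le_u: "w x \<le> u x" for x by (auto simp: u_def)
  have [measurable]: "u \<in> borel_measurable m" by (simp add: u_def[abs_def])
  define \<mu> where "\<mu> = density m (\<lambda>x. ennreal (u x))"
  define Q where "Q = {x \<in> M. w x > 0}"
  have "{x \<in> space m. 0 < w x} \<in> sets m" by measurable
  then have Q[measurable]: "Q \<in> sets m" by (simp add: Q_def)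
  have sets_\<mu>: "sets \<mu> = sets m" by (simp add: \<mu>_def)
  have sp_\<mu>: "space \<mu> = M" by (simp add: \<mu>_def)
  have "emeasure \<mu> (space \<mu>) = (\<integral>\<^sup>+x. ennreal (u x) \<partial>m)"
    by (simp add: \<mu>_def emeasure_density_M)
  also have "\<dots> < \<infinity>" using uL u_nn by (simp add: nn_integral_eq_integral L1_integrable)
  finally have fin: "finite_measure \<mu>" by (intro finite_measureI) auto
  interpret \<mu>: finite_measure \<mu> by (rule fin)
  have ms: "measure \<mu> A = (LINT x|m. u x * indicator A x)" if A[measurable]: "A \<in> sets m" for A
  proof -
    have "measure \<mu> A = (LINT x|\<mu>. indicator A x)" using A by (simp add: sets_\<mu>)
    also have "\<dots> = (LINT x|m. u x * indicator A x)"
      unfolding \<mu>_def using u_nn by (subst integral_density) auto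
    finally show ?thesis .
  qed
  \<comment> \<open>On \<open>Q\<close> the functions \<open>u\<close> and \<open>w\<close> agree,
    so \<open>w\<close> can be tested against \<open>A \<inter> Q\<close>; after composition with
    \<open>T\<close> only \<open>w \<le> u\<close> and \<open>u \<ge> 0\<close> enter.\<close>
  have le: "measure \<mu> A \<le> measure \<mu> (T -` A \<inter> M)" if A: "A \<in> sets m" for A
  proof -
    have TA: "T -` A \<inter> M \<in> sets m" using measurable_sets[OF T_measurable A] by simp
    have AQ: "indicator (A \<inter> Q) \<in> Linf M" using A Q by (intro indicator_Linf) auto
    have "measure \<mu> A = (LINT x|m. w x * indicator (A \<inter> Q) x)"
      unfolding ms[OF A] by (intro Bochner_Integration.integral_cong) (auto simp: u_def Q_def indicator_def)
    also have "\<dots> = (LINT x|m. w x * indicator (A \<inter> Q) (T x))"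
      using w AQ unfolding inv_density_def by metis
    also have "\<dots> \<le> (LINT x|m. u x * indicator (T -` A \<inter> M) x)"
    proof (rule integral_mono)
      show "integrable m (\<lambda>x. w x * indicator (A \<inter> Q) (T x))"
        by (rule integrable_mult_Linf[OF wL Linf_comp_T[OF AQ]])
      show "integrable m (\<lambda>x. u x * indicator (T -` A \<inter> M) x)"
        by (rule integrable_mult_Linf[OF uL indicator_Linf[OF TA]])
    qed (auto simp: indicator_def u_nn w_le_u)
    finally show ?thesis using ms[OF TA] by simp
  qed
  \<comment> \<open>The inequality for \<open>A\<close> and for its complement, with finite total
    mass, forces equality.\<close>
  have "measure \<mu> (T -` A \<inter> M) = measure \<mu> A" if A: "A \<in> sets m" for A
  proof -
    have cA: "M - A \<in> sets m" using sets.compl_sets[OF A] by simp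
    have TA: "T -` A \<inter> M \<in> sets m" using measurable_sets[OF T_measurable A] by simp
    have "T -` (M - A) \<inter> M = M - (T -` A \<inter> M)" using T_in_M by auto
    then show ?thesis
      using le[OF A] le[OF cA] \<mu>.finite_measure_compl[of A] \<mu>.finite_measure_compl[of "T -` A \<inter> M"] A TA
      by (simp add: sets_\<mu> sp_\<mu>)
  qed
  moreover have "measure \<mu> I > 0"
  proof -
    have "(LINT x|m. w x * indicator I x) \<le> (LINT x|m. u x * indicator I x)"
      by (intro integral_mono integrable_mult_Linf indicator_Linf I wL uL)
         (auto simp: indicator_def w_le_u)
    then show ?thesis using pos ms[OF I(1)] by simp
  qed
  moreover have "absolutely_continuous m \<mu>"
    unfolding \<mu>_def by (rule absolutely_continuousI_density) simp
  ultimately have "acim M T (uniform_measure \<mu> I)"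
    using I by (intro acim_uniform_measure fin sets_\<mu>)
  moreover have "AE x in uniform_measure \<mu> I. x \<in> I"
    using I by (intro AE_uniform_measureI) (auto simp: sets_\<mu>)
  ultimately show ?thesis by blast
qed

text \<open>
  For densities \<open>w\<^sub>1, w\<^sub>2\<close> of the two measures, invariance makes the integral of
  \<open>d (1\<^sub>P - 1\<^sub>P \<circ> T)\<close> vanish, where \<open>d = w\<^sub>1 - w\<^sub>2\<close> and \<open>P = {d > 0}\<close>; the integrand is non-negative,
  so \<open>P\<close> is forward invariant up to a null set.
\<close>

lemma ergodic_acims_separated:
  assumes e1: "ergodic_acim M T \<nu>\<^sub>1" and e2: "ergodic_acim M T \<nu>\<^sub>2" and ne: "\<nu>\<^sub>1 \<noteq> \<nu>\<^sub>2"
  shows "\<exists>P\<in>sets m. measure \<nu>\<^sub>1 P = 1 \<and> measure \<nu>\<^sub>2 P = 0"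
proof -
  have a1: "acim M T \<nu>\<^sub>1" and a2: "acim M T \<nu>\<^sub>2" using e1 e2 by (auto simp: ergodic_acim_def)
  obtain w1 where w1: "inv_density w1" "\<nu>\<^sub>1 = density m (\<lambda>x. ennreal (w1 x))"
    "\<And>A. A \<in> sets m \<Longrightarrow> measure \<nu>\<^sub>1 A = (LINT x|m. w1 x * indicator A x)"
    by (rule acim_density[OF a1]) blast
  obtain w2 where w2: "inv_density w2" "\<nu>\<^sub>2 = density m (\<lambda>x. ennreal (w2 x))"
    "\<And>A. A \<in> sets m \<Longrightarrow> measure \<nu>\<^sub>2 A = (LINT x|m. w2 x * indicator A x)"
    by (rule acim_density[OF a2]) blast
  have wL: "w1 \<in> L1 M" "w2 \<in> L1 M" using w1 w2 by (auto simp: inv_density_def)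
  then have [measurable]: "w1 \<in> borel_measurable m" "w2 \<in> borel_measurable m" by (auto simp: L1_integrable)
  define d where "d x = w1 x - w2 x" for x
  have dL: "d \<in> L1 M" using L1_diff[OF wL] by (simp add: d_def[abs_def])
  have [measurable]: "d \<in> borel_measurable m" by (simp add: d_def[abs_def])
  have d_int: "(LINT x|m. d x * g x) = (LINT x|m. w1 x * g x) - (LINT x|m. w2 x * g x)" if "g \<in> Linf M" for g
    using integrable_mult_Linf[OF wL(1) that] integrable_mult_Linf[OF wL(2) that]
    by (simp add: d_def left_diff_distrib)
  define P where "P = {x \<in> M. d x > 0}"
  have "{x \<in> space m. 0 < d x} \<in> sets m" by measurable
  then have P: "P \<in> sets m" by (simp add: P_def)
  have iP: "indicator P \<in> Linf M" by (rule indicator_Linf[OF P])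
  let ?k = "\<lambda>x. d x * indicator P x - d x * indicator P (T x)"
  have ints: "integrable m (\<lambda>x. d x * indicator P x)" "integrable m (\<lambda>x. d x * indicator P (T x))"
    using integrable_mult_Linf[OF dL iP] integrable_mult_Linf[OF dL Linf_comp_T[OF iP]] by auto
  have "integral\<^sup>L m ?k = 0"
    using ints d_int[OF iP] d_int[OF Linf_comp_T[OF iP]] w1(1) w2(1) iP by (auto simp: inv_density_def)
  moreover have "AE x in m. 0 \<le> ?k x"
    by (rule AE_I2) (auto simp: P_def indicator_def)
  ultimately have "AE x in m. ?k x = 0"
    using ints by (subst (asm) integral_nonneg_eq_0_iff_AE) auto
  then have fwd: "AE x in m. x \<in> P \<longrightarrow> T x \<in> P"
    by eventually_elim (auto simp: P_def indicator_def split: if_splits)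
  have fwd1: "AE x in \<nu>\<^sub>1. x \<in> P \<longrightarrow> T x \<in> P"
    by (rule absolutely_continuous_AE[OF _ acimD(5)[OF a1] fwd]) (simp add: acimD(2)[OF a1])
  have fwd2: "AE x in \<nu>\<^sub>2. x \<in> P \<longrightarrow> T x \<in> P"
    by (rule absolutely_continuous_AE[OF _ acimD(5)[OF a2] fwd]) (simp add: acimD(2)[OF a2])
  have P01: "measure \<nu>\<^sub>1 P \<in> {0, 1}" "measure \<nu>\<^sub>2 P \<in> {0, 1}"
    using ergodic_forward_invariant[OF e1 P fwd1] ergodic_forward_invariant[OF e2 P fwd2] by auto
  have diff: "measure \<nu>\<^sub>1 P - measure \<nu>\<^sub>2 P = (LINT x|m. d x * indicator P x)"
    using d_int[OF iP] w1(3)[OF P] w2(3)[OF P] by simp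
  have dP_nn: "AE x in m. 0 \<le> d x * indicator P x"
    by (rule AE_I2) (auto simp: P_def indicator_def)
  \<comment> \<open>Otherwise \<open>d \<le> 0\<close> almost everywhere; its integral is a
    difference of two total masses 1, so \<open>d = 0\<close> and the measures agree. A nonzero
    value is positive here and a difference of two numbers in \<open>{0, 1}\<close>, hence it is 1 -
    0.\<close>
  have "(LINT x|m. d x * indicator P x) \<noteq> 0"
  proof
    assume "(LINT x|m. d x * indicator P x) = 0"
    then have "AE x in m. d x * indicator P x = 0"
      using ints dP_nn by (subst (asm) integral_nonneg_eq_0_iff_AE) auto
    moreover have "AE x in m. x \<in> M" using AE_space[of m] by simp
    ultimately have d_np: "AE x in m. 0 \<le> - d x"
      by eventually_elim (auto simp: P_def indicator_def split: if_splits)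
    have iM: "indicator M \<in> Linf M" using indicator_Linf[of M] sets.top[of m] by simp
    have Mm: "M \<in> sets m" using sets.top[of m] by simp
    have "integral\<^sup>L m d = (LINT x|m. d x * indicator M x)"
      by (intro Bochner_Integration.integral_cong) auto
    also have "\<dots> = measure \<nu>\<^sub>1 M - measure \<nu>\<^sub>2 M"
      using d_int[OF iM] w1(3)[OF Mm] w2(3)[OF Mm] by simp
    also have "\<dots> = 0"
      using prob_space.prob_space[OF acimD(1)[OF a1]] prob_space.prob_space[OF acimD(1)[OF a2]]
      by (simp add: acimD(3)[OF a1] acimD(3)[OF a2])
    finally have "(LINT x|m. - d x) = 0" by simp
    then have "AE x in m. - d x = 0"
      using dL d_np by (subst (asm) integral_nonneg_eq_0_iff_AE) (auto simp: L1_integrable)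
    then have "AE x in m. ennreal (w1 x) = ennreal (w2 x)" by eventually_elim (simp add: d_def)
    then have "\<nu>\<^sub>1 = \<nu>\<^sub>2" unfolding w1(2) w2(2) by (intro density_cong) auto
    then show False using ne by simp
  qed
  moreover have "(LINT x|m. d x * indicator P x) \<ge> 0" using dP_nn by (rule integral_nonneg_AE)
  ultimately have "measure \<nu>\<^sub>1 P = 1 \<and> measure \<nu>\<^sub>2 P = 0" using diff P01 by auto
  then show ?thesis using P by blast
qed

subsection \<open>Finitely many ergodic components\<close>

lemma openin_L1_ball:
  assumes f: "f \<in> L1 M"
  shows "openin (L1_topology M) {g \<in> L1 M. L1_norm M (\<lambda>x. g x - f x) < r}"
  unfolding openin_L1_topology
proof (intro conjI ballI)
  fix g assume g: "g \<in> {g \<in> L1 M. L1_norm M (\<lambda>x. g x - f x) < r}"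
  show "\<exists>s>0. \<forall>h\<in>L1 M. L1_norm M (\<lambda>x. h x - g x) < s \<longrightarrow> h \<in> {g \<in> L1 M. L1_norm M (\<lambda>x. g x - f x) < r}"
  proof (intro exI[of _ "r - L1_norm M (\<lambda>x. g x - f x)"] conjI ballI impI)
    fix h assume "h \<in> L1 M" "L1_norm M (\<lambda>x. h x - g x) < r - L1_norm M (\<lambda>x. g x - f x)"
    then show "h \<in> {g \<in> L1 M. L1_norm M (\<lambda>x. g x - f x) < r}"
      using g L1_norm_triangle[of h g f] f by auto
  qed (use g in simp)
qed auto

lemma L1_norm_nonneg: "0 \<le> L1_norm M f"
  by (simp add: L1_norm_def)

lemma L1_norm_cmult: "L1_norm M (\<lambda>x. c * f x) = \<bar>c\<bar> * L1_norm M f"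
  by (simp add: L1_norm_def abs_mult)

lemma L1_norm_0: "L1_norm M (\<lambda>x. 0) = 0"
  by (simp add: L1_norm_def)

lemma L1_norm_add:
  assumes "f \<in> L1 M" "g \<in> L1 M"
  shows "L1_norm M (\<lambda>x. f x + g x) \<le> L1_norm M f + L1_norm M g"
  using L1_norm_triangle[of f "\<lambda>x. 0" "\<lambda>x. - g x"] assms
  by (simp add: L1_integrable L1_norm_def)

lemma topspace_L1_topology_subset: "topspace (L1_topology M) \<subseteq> L1 M"
  using openin_topspace[of "L1_topology M"] unfolding openin_L1_topology by blast

text \<open>A point that is not a cluster point has a ball that the sequence avoids from some index
  on. If this held for all points of \<open>K\<close>, finitely many such balls would cover
  \<open>K\<close> and the sequence would have nowhere to be.\<close>

lemma cluster_point:
  assumes K: "compactin (L1_topology M) K" and c: "\<And>n :: nat. c n \<in> K"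
  shows "\<exists>w\<in>L1 M. \<forall>r>0. \<forall>N. \<exists>n\<ge>N. L1_norm M (\<lambda>x. c n x - w x) < r"
proof (rule ccontr)
  have KL: "K \<subseteq> L1 M"
    using compactin_subset_topspace[OF K] topspace_L1_topology_subset by blast
  assume "\<not> ?thesis"
  then have "\<forall>w\<in>K. \<exists>r N. r > 0 \<and> (\<forall>n\<ge>N. \<not> L1_norm M (\<lambda>x. c n x - w x) < r)"
    using KL by blast
  then obtain r N where rN: "\<And>w. w \<in> K \<Longrightarrow> r w > 0"
    "\<And>w n. w \<in> K \<Longrightarrow> n \<ge> N w \<Longrightarrow> \<not> L1_norm M (\<lambda>x. c n x - w x) < r w"
    by metis
  let ?b = "\<lambda>w. {g \<in> L1 M. L1_norm M (\<lambda>x. g x - w x) < r w}"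
  have "\<forall>U\<in>?b ` K. openin (L1_topology M) U" using KL openin_L1_ball by blast
  moreover have "K \<subseteq> \<Union>(?b ` K)" using KL rN(1) by (auto simp: L1_norm_0)
  ultimately obtain F where F: "finite F" "F \<subseteq> ?b ` K" "K \<subseteq> \<Union>F"
    using K unfolding compactin_def by meson
  obtain W where W: "finite W" "W \<subseteq> K" "F = ?b ` W"
    using finite_subset_image[OF F(1,2)] by blast
  define n where "n = Max (insert 0 (N ` W))"
  have "c n \<in> \<Union>(?b ` W)" using c F(3) W(3) by blast
  then obtain w where w: "w \<in> W" "L1_norm M (\<lambda>x. c n x - w x) < r w" by blast
  have "N w \<le> n" using W(1) w(1) by (auto simp: n_def intro!: Max_ge)
  then show False using rN(2)[of w n] w W(2) by blast
qed

lemma finite_net: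
  assumes K: "compactin (L1_topology M) K" and r: "r > 0"
  shows "\<exists>F. finite F \<and> F \<subseteq> L1 M \<and> (\<forall>f\<in>K. \<exists>g\<in>F. L1_norm M (\<lambda>x. f x - g x) < r)"
proof -
  have KL: "K \<subseteq> L1 M"
    using compactin_subset_topspace[OF K] topspace_L1_topology_subset by blast
  let ?b = "\<lambda>w. {g \<in> L1 M. L1_norm M (\<lambda>x. g x - w x) < r}"
  have "\<forall>U\<in>?b ` K. openin (L1_topology M) U" using KL openin_L1_ball by blast
  moreover have "K \<subseteq> \<Union>(?b ` K)" using KL r by (auto simp: L1_norm_0)
  ultimately obtain F where F: "finite F" "F \<subseteq> ?b ` K" "K \<subseteq> \<Union>F"
    using K unfolding compactin_def by meson
  obtain W where W: "finite W" "W \<subseteq> K" "F = ?b ` W"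
    using finite_subset_image[OF F(1,2)] by blast
  have "\<exists>g\<in>W. L1_norm M (\<lambda>x. f x - g x) < r" if "f \<in> K" for f
    using that F(3) W(3) by blast
  then show ?thesis using W KL by blast
qed

end

locale lasota_yorke = nonsingular_system M T
  for M :: "'a::euclidean_space set" and T +
  fixes B :: "('a \<Rightarrow> real) set" and sn :: "('a \<Rightarrow> real) \<Rightarrow> real" and \<eta> D :: real
  assumes B3: "B3 M B sn" and dense: "L1_dense M B"
    and \<eta>: "0 < \<eta>" "\<eta> < 1" and D: "0 < D" and LY: "LY M T B sn \<eta> D"
begin

section \<open>Bounded sets of \<open>B\<close> and iteration of the Lasota-Yorke inequality\<close>

lemma compact_ball: "compactin (L1_topology M) {f \<in> B. B_norm M sn f \<le> 1}"
  using B3 by (simp add: B3_def)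

lemma B_L1: "f \<in> B \<Longrightarrow> f \<in> L1 M"
  and zero_B: "(\<lambda>x. 0) \<in> B"
  and add_B: "f \<in> B \<Longrightarrow> g \<in> B \<Longrightarrow> (\<lambda>x. f x + g x) \<in> B"
  and sn_add: "f \<in> B \<Longrightarrow> g \<in> B \<Longrightarrow> sn (\<lambda>x. f x + g x) \<le> sn f + sn g"
  and cmult_B: "f \<in> B \<Longrightarrow> (\<lambda>x. c * f x) \<in> B"
  and sn_cmult: "f \<in> B \<Longrightarrow> sn (\<lambda>x. c * f x) = \<bar>c\<bar> * sn f"
  and sn_nonneg: "f \<in> B \<Longrightarrow> 0 \<le> sn f"
  using B3 unfolding B3_def seminormed_subspace_def by blast+

lemma B_norm_cmult: "f \<in> B \<Longrightarrow> B_norm M sn (\<lambda>x. c * f x) = \<bar>c\<bar> * B_norm M sn f"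
  by (simp add: B_norm_def sn_cmult L1_norm_cmult distrib_left)

lemma inverse_cmult_in_ball:
  assumes "f \<in> B" "B_norm M sn f \<le> K" "K > 0"
  shows "(\<lambda>x. inverse K * f x) \<in> {f \<in> B. B_norm M sn f \<le> 1}"
proof -
  have "B_norm M sn (\<lambda>x. inverse K * f x) = inverse K * B_norm M sn f"
    using B_norm_cmult[OF assms(1), of "inverse K"] assms(3) by simp
  also have "\<dots> \<le> inverse K * K" using assms by (intro mult_left_mono) auto
  finally show ?thesis using cmult_B[OF assms(1), of "inverse K"] assms(3) by simp
qed

lemma B_norm_sum_le:
  assumes "\<And>k. k < n \<Longrightarrow> f k \<in> B \<and> B_norm M sn (f k) \<le> K"
  shows "(\<lambda>x. \<Sum>k<n. f k x) \<in> B \<and> B_norm M sn (\<lambda>x. \<Sum>k<n. f k x) \<le> real n * K"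
  using assms
proof (induction n)
  case 0
  have "sn (\<lambda>x. 0) = 0" using sn_cmult[OF zero_B, of 0] by simp
  then show ?case using zero_B by (simp add: B_norm_def L1_norm_0)
next
  case (Suc n)
  then have IH: "(\<lambda>x. \<Sum>k<n. f k x) \<in> B" "B_norm M sn (\<lambda>x. \<Sum>k<n. f k x) \<le> real n * K"
    and fn: "f n \<in> B" "B_norm M sn (f n) \<le> K" by auto
  have "B_norm M sn (\<lambda>x. (\<Sum>k<n. f k x) + f n x) \<le> real n * K + K"
    using sn_add[OF IH(1) fn(1)] L1_norm_add[OF B_L1[OF IH(1)] B_L1[OF fn(1)]] IH(2) fn(2)
    by (simp add: B_norm_def)
  then show ?case using add_B[OF IH(1) fn(1)] by (simp add: algebra_simps)
qed

lemma cluster_point_B: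
  assumes K: "K > 0" and c: "\<And>n :: nat. c n \<in> B \<and> B_norm M sn (c n) \<le> K"
  shows "\<exists>w\<in>L1 M. \<forall>r>0. \<forall>N. \<exists>n\<ge>N. L1_norm M (\<lambda>x. c n x - w x) < r"
proof -
  have "(\<lambda>x. inverse K * c n x) \<in> {f \<in> B. B_norm M sn f \<le> 1}" for n
    using c[of n] K by (intro inverse_cmult_in_ball) auto
  from cluster_point[OF compact_ball this] obtain w where w: "w \<in> L1 M"
    "\<forall>r>0. \<forall>N. \<exists>n\<ge>N. L1_norm M (\<lambda>x. inverse K * c n x - w x) < r" by (rule bexE)
  show ?thesis
  proof (intro bexI[of _ "\<lambda>x. K * w x"] allI impI)
    fix r :: real and N assume "r > 0"
    then obtain n where n: "n \<ge> N" "L1_norm M (\<lambda>x. inverse K * c n x - w x) < r / K"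
      using w(2)[rule_format, of "r / K" N] K by auto
    have "L1_norm M (\<lambda>x. c n x - K * w x) = L1_norm M (\<lambda>x. K * (inverse K * c n x - w x))"
      using K by (simp add: right_diff_distrib mult.assoc[symmetric])
    also have "\<dots> < r" using n(2) K by (simp only: L1_norm_cmult) (simp add: field_simps)
    finally show "\<exists>n\<ge>N. L1_norm M (\<lambda>x. c n x - K * w x) < r" using n(1) by blast
  qed (use w in \<open>simp add: L1_integrable\<close>)
qed

lemma finite_net_B:
  assumes K: "K > 0" and r: "r > 0"
  shows "\<exists>F. finite F \<and> F \<subseteq> L1 M \<and>
    (\<forall>f\<in>B. B_norm M sn f \<le> K \<longrightarrow> (\<exists>g\<in>F. L1_norm M (\<lambda>x. f x - g x) < r))"
proof -
  obtain F where F: "finite F" "F \<subseteq> L1 M"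
    "\<And>f. f \<in> {f \<in> B. B_norm M sn f \<le> 1} \<Longrightarrow> \<exists>g\<in>F. L1_norm M (\<lambda>x. f x - g x) < r / K"
    using finite_net[OF compact_ball, of "r / K"] K r by fastforce
  have "\<exists>g\<in>(\<lambda>g x. K * g x) ` F. L1_norm M (\<lambda>x. f x - g x) < r" if "f \<in> B" "B_norm M sn f \<le> K" for f
  proof -
    have "(\<lambda>x. inverse K * f x) \<in> {f \<in> B. B_norm M sn f \<le> 1}"
      using that K by (intro inverse_cmult_in_ball)
    then obtain g where g: "g \<in> F" "L1_norm M (\<lambda>x. inverse K * f x - g x) < r / K" using F(3) by blast
    have "L1_norm M (\<lambda>x. f x - K * g x) = L1_norm M (\<lambda>x. K * (inverse K * f x - g x))"
      using K by (simp add: right_diff_distrib mult.assoc[symmetric])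
    also have "\<dots> < r" using g(2) K by (simp only: L1_norm_cmult) (simp add: field_simps)
    finally show ?thesis using g(1) by (intro rev_bexI[OF imageI])
  qed
  moreover have "(\<lambda>g x. K * g x) ` F \<subseteq> L1 M" using F(2) by (auto simp: L1_integrable)
  ultimately show ?thesis using F(1) by blast
qed

lemma funpow_transfer_op_B:
  assumes b: "b \<in> B"
  shows "(transfer_op M T ^^ n) b \<in> B" (is "?f n \<in> B")
    and "L1_norm M ((transfer_op M T ^^ n) b) \<le> L1_norm M b"
    and "sn ((transfer_op M T ^^ n) b) \<le> \<eta> ^ n * sn b + D / (1 - \<eta>) * L1_norm M b"
proof -
  show B: "?f n \<in> B" for n
    using LY b by (induction n) (auto simp: LY_def)
  show L1: "L1_norm M (?f n) \<le> L1_norm M b" for n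
    using funpow_transfer_op_contracts[OF B_L1[OF b] inv_density_0, of n] by simp
  show "sn (?f n) \<le> \<eta> ^ n * sn b + D / (1 - \<eta>) * L1_norm M b"
  proof (induction n)
    case 0
    show ?case using \<eta> D L1_norm_nonneg[of b] by simp
  next
    case (Suc n)
    have "sn (?f (Suc n)) \<le> \<eta> * sn (?f n) + D * L1_norm M (?f n)"
      using LY B[of n] by (simp add: LY_def)
    also have "\<dots> \<le> \<eta> * (\<eta> ^ n * sn b + D / (1 - \<eta>) * L1_norm M b) + D * L1_norm M b"
      using Suc L1[of n] \<eta> D by (intro add_mono mult_left_mono) auto
    also have "\<dots> = \<eta> ^ Suc n * sn b + (\<eta> * (D / (1 - \<eta>)) + D) * L1_norm M b"
      by (simp add: algebra_simps)
    also have "\<eta> * (D / (1 - \<eta>)) + D = D / (1 - \<eta>)" using \<eta> by (simp add: field_simps)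
    finally show ?case .
  qed
qed

text \<open>For a start \<open>b\<close> of L1 norm at most 2: 1 bounds the decayed
  \<open>\<eta> ^ n * sn b\<close>, 2 the L1 norm, and \<open>2 * (D / (1 - \<eta>))\<close> the
  remaining term of the iterated inequality.\<close>

definition LY_radius :: real where
  "LY_radius = 3 + 2 * (D / (1 - \<eta>))"

lemma LY_radius_pos: "LY_radius > 0"
  using \<eta> D by (simp add: LY_radius_def add_pos_nonneg)

text \<open>An approximation \<open>b\<close> of \<open>w\<close> in \<open>B\<close> may have a
  huge semi-norm. Iterating the transfer operator brings the semi-norm under a bound independent of
  \<open>b\<close> and does not increase the distance to the fixed \<open>w\<close>. So all these
  densities are approximated from one ball of \<open>B\<close>.\<close>

lemma inv_density_approx:
  assumes w: "inv_density w" "L1_norm M w \<le> 1" and d: "0 < d" "d \<le> 1"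
  shows "\<exists>f\<in>B. B_norm M sn f \<le> LY_radius \<and> L1_norm M (\<lambda>x. f x - w x) < d"
proof -
  have wL: "w \<in> L1 M" using w by (simp add: inv_density_def)
  obtain b where b: "b \<in> B" "L1_norm M (\<lambda>x. b x - w x) < d"
    using dense wL d by (auto simp: L1_dense_def)
  have bn: "L1_norm M b \<le> 2"
    using L1_norm_add[OF L1_diff[OF B_L1[OF b(1)] wL] wL] b(2) w(2) d by simp
  have "\<exists>n. \<eta> ^ n * sn b \<le> 1"
  proof (cases "sn b = 0")
    case False
    then have "sn b > 0" using sn_nonneg[OF b(1)] by simp
    then obtain n where "\<eta> ^ n < 1 / sn b" using real_arch_pow_inv[of "1 / sn b" \<eta>] \<eta> by auto
    then show ?thesis using \<open>sn b > 0\<close> by (intro exI[of _ n]) (simp add: field_simps)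
  qed simp
  then obtain n where n: "\<eta> ^ n * sn b \<le> 1" by blast
  define f where "f = (transfer_op M T ^^ n) b"
  have q: "D / (1 - \<eta>) * L1_norm M b \<le> 2 * (D / (1 - \<eta>))"
    using bn \<eta> D mult_right_mono[of "L1_norm M b" 2 "D / (1 - \<eta>)"]
    by (simp only: mult.commute[of "D / (1 - \<eta>)" "L1_norm M b"]) simp
  have "sn f \<le> 1 + D / (1 - \<eta>) * L1_norm M b"
    using funpow_transfer_op_B(3)[OF b(1), of n] n unfolding f_def by (rule order_trans[OF _ add_right_mono])
  then have "sn f \<le> 1 + 2 * (D / (1 - \<eta>))" using q by (rule order_trans[OF _ add_left_mono])
  moreover have "L1_norm M f \<le> 2"
    using funpow_transfer_op_B(2)[OF b(1), of n] bn unfolding f_def by (rule order_trans)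
  ultimately have "B_norm M sn f \<le> LY_radius"
    unfolding B_norm_def LY_radius_def by simp
  moreover have "L1_norm M (\<lambda>x. f x - w x) < d"
    using funpow_transfer_op_contracts[OF B_L1[OF b(1)] w(1), of n] b(2) by (simp add: f_def)
  moreover have "f \<in> B" using funpow_transfer_op_B(1)[OF b(1)] by (simp add: f_def)
  ultimately show ?thesis by blast
qed

text \<open>A separating set forces two densities to be at L1 distance at least 1. Each lies within
  1/4 + 1/4 of a finite net for the ball of radius \<open>LY_radius\<close>, so two of them cannot
  share a net point. Asking for separation only, the bound serves both for distinct ergodic measures
  and for restrictions of one measure to disjoint invariant sets.\<close>

lemma separated_acims_bounded:
  "\<exists>N. \<forall>X. finite X \<longrightarrow> (\<forall>\<nu>\<in>X. acim M T \<nu>) \<longrightarrow>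
    (\<forall>\<nu>\<in>X. \<forall>\<nu>'\<in>X. \<nu> \<noteq> \<nu>' \<longrightarrow> (\<exists>P\<in>sets m. measure \<nu> P = 1 \<and> measure \<nu>' P = 0)) \<longrightarrow> card X \<le> N"
proof -
  obtain F where F: "finite F" "F \<subseteq> L1 M"
    "\<And>f. f \<in> B \<Longrightarrow> B_norm M sn f \<le> LY_radius \<Longrightarrow> \<exists>g\<in>F. L1_norm M (\<lambda>x. f x - g x) < 1/4"
    using finite_net_B[OF LY_radius_pos, of "1/4"] by auto
  have "card X \<le> card F" if ac: "\<forall>\<nu>\<in>X. acim M T \<nu>"
    and sep: "\<forall>\<nu>\<in>X. \<forall>\<nu>'\<in>X. \<nu> \<noteq> \<nu>' \<longrightarrow> (\<exists>P\<in>sets m. measure \<nu> P = 1 \<and> measure \<nu>' P = 0)" for X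
  proof -
    have "\<forall>\<nu>\<in>X. \<exists>w g. w \<in> L1 M \<and> (\<forall>A\<in>sets m. measure \<nu> A = (LINT x|m. w x * indicator A x)) \<and>
        g \<in> F \<and> L1_norm M (\<lambda>x. w x - g x) < 1/2"
    proof
      fix \<nu> assume "\<nu> \<in> X"
      then have \<nu>: "acim M T \<nu>" using ac by blast
      obtain w where w: "inv_density w" "\<And>x. 0 \<le> w x"
        "\<And>A. A \<in> sets m \<Longrightarrow> measure \<nu> A = (LINT x|m. w x * indicator A x)"
        by (rule acim_density[OF \<nu>]) blast
      have wL: "w \<in> L1 M" using w by (simp add: inv_density_def)
      have "L1_norm M w = (LINT x|m. w x * indicator M x)"
        unfolding L1_norm_def using w(2) by (intro Bochner_Integration.integral_cong) auto
      also have "\<dots> = measure \<nu> M" using w(3)[of M] sets.top[of m] by simp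
      also have "\<dots> \<le> 1" using prob_space.prob_le_1[OF acimD(1)[OF \<nu>]] .
      finally obtain f where f: "f \<in> B" "B_norm M sn f \<le> LY_radius" "L1_norm M (\<lambda>x. f x - w x) < 1/4"
        using inv_density_approx[OF w(1), of "1/4"] by auto
      obtain g where g: "g \<in> F" "L1_norm M (\<lambda>x. f x - g x) < 1/4" using F(3)[OF f(1,2)] by blast
      have "L1_norm M (\<lambda>x. w x - g x) < 1/2"
        using L1_norm_triangle[OF wL B_L1[OF f(1)], of g] f(3) g F(2) L1_norm_commute[of w f] by auto
      then show "\<exists>w g. w \<in> L1 M \<and> (\<forall>A\<in>sets m. measure \<nu> A = (LINT x|m. w x * indicator A x)) \<and>
        g \<in> F \<and> L1_norm M (\<lambda>x. w x - g x) < 1/2"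
        using wL w(3) g(1) by (intro exI[of _ w] exI[of _ g]) auto
    qed
    then obtain w where w: "\<forall>\<nu>\<in>X. \<exists>g. w \<nu> \<in> L1 M \<and>
        (\<forall>A\<in>sets m. measure \<nu> A = (LINT x|m. w \<nu> x * indicator A x)) \<and>
        g \<in> F \<and> L1_norm M (\<lambda>x. w \<nu> x - g x) < 1/2"
      by (rule bchoice[THEN exE])
    then obtain g where wg_all: "\<forall>\<nu>\<in>X. w \<nu> \<in> L1 M \<and>
        (\<forall>A\<in>sets m. measure \<nu> A = (LINT x|m. w \<nu> x * indicator A x)) \<and>
        g \<nu> \<in> F \<and> L1_norm M (\<lambda>x. w \<nu> x - g \<nu> x) < 1/2"
      by (rule bchoice[THEN exE])
    have wg: "\<And>\<nu>. \<nu> \<in> X \<Longrightarrow> w \<nu> \<in> L1 M"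
      "\<And>\<nu> A. \<nu> \<in> X \<Longrightarrow> A \<in> sets m \<Longrightarrow> measure \<nu> A = (LINT x|m. w \<nu> x * indicator A x)"
      "\<And>\<nu>. \<nu> \<in> X \<Longrightarrow> g \<nu> \<in> F" "\<And>\<nu>. \<nu> \<in> X \<Longrightarrow> L1_norm M (\<lambda>x. w \<nu> x - g \<nu> x) < 1/2"
      using wg_all by (auto simp del: times_divide_eq_right)
    have "inj_on g X"
    proof (rule inj_onI, rule ccontr)
      fix \<nu> \<nu>' assume X: "\<nu> \<in> X" "\<nu>' \<in> X" "g \<nu> = g \<nu>'" "\<nu> \<noteq> \<nu>'"
      then obtain P where P: "P \<in> sets m" "measure \<nu> P = 1" "measure \<nu>' P = 0" using sep by blast
      have iP: "indicator P \<in> Linf M" by (rule indicator_Linf[OF P(1)])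
      have "1 = (LINT x|m. w \<nu> x * indicator P x) - (LINT x|m. w \<nu>' x * indicator P x)"
        using P wg(2) X by simp
      also have "\<dots> = (LINT x|m. (w \<nu> x - w \<nu>' x) * indicator P x)"
        using integrable_mult_Linf[OF wg(1)[OF X(1)] iP] integrable_mult_Linf[OF wg(1)[OF X(2)] iP]
        by (simp add: left_diff_distrib)
      also have "\<dots> \<le> 1 * L1_norm M (\<lambda>x. w \<nu> x - w \<nu>' x)"
      proof -
        have "AE x in m. \<bar>indicator P x :: real\<bar> \<le> 1" by (rule AE_I2) (simp add: indicator_def)
        then show ?thesis
          using abs_integral_mult_le[OF L1_diff[OF wg(1)[OF X(1)] wg(1)[OF X(2)]] iP] by fastforce
      qed
      also have "\<dots> < 1"
      proof -
        have "g \<nu> \<in> L1 M" using wg(3)[OF X(1)] F(2) by blast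
        then show ?thesis
          using L1_norm_triangle[OF wg(1)[OF X(1)] _ wg(1)[OF X(2)], of "g \<nu>"] wg(4)[OF X(1)] wg(4)[OF X(2)]
            L1_norm_commute[of "g \<nu>" "w \<nu>'"] X(3) by simp
      qed
      finally show False by simp
    qed
    then show "card X \<le> card F"
      using wg(3) by (intro card_inj_on_le[of g] F(1)) auto
  qed
  then show ?thesis by blast
qed

lemma finite_ergodic_acims: "finite {\<nu>. ergodic_acim M T \<nu>}"
proof (rule ccontr)
  assume inf: "infinite {\<nu>. ergodic_acim M T \<nu>}"
  obtain N where N: "\<And>X. finite X \<Longrightarrow> \<forall>\<nu>\<in>X. acim M T \<nu> \<Longrightarrow>
    \<forall>\<nu>\<in>X. \<forall>\<nu>'\<in>X. \<nu> \<noteq> \<nu>' \<longrightarrow> (\<exists>P\<in>sets m. measure \<nu> P = 1 \<and> measure \<nu>' P = 0) \<Longrightarrow> card X \<le> N"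
    using separated_acims_bounded by blast
  obtain X where X: "finite X" "card X = Suc N" "X \<subseteq> {\<nu>. ergodic_acim M T \<nu>}"
    using infinite_arbitrarily_large[OF inf] by blast
  have "card X \<le> N"
  proof (rule N[OF X(1)])
    show "\<forall>\<nu>\<in>X. acim M T \<nu>" using X(3) by (auto simp: ergodic_acim_def)
    show "\<forall>\<nu>\<in>X. \<forall>\<nu>'\<in>X. \<nu> \<noteq> \<nu>' \<longrightarrow> (\<exists>P\<in>sets m. measure \<nu> P = 1 \<and> measure \<nu>' P = 0)"
      using X(3) ergodic_acims_separated by blast
  qed
  then show False using X(2) by simp
qed

lemma finite_ergodic_supports: "finite (ergodic_supports M T)"
  using finite_ergodic_acims by (simp add: ergodic_supports_def)

text \<open>
  Disjoint families of invariant sets of positive measure have bounded size, so the members of a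
  largest one are atoms of the invariant \<open>\<sigma>\<close>-algebra.
\<close>

lemma ergodic_component:
  assumes \<nu>: "acim M T \<nu>"
  shows "\<exists>\<nu>'. ergodic_acim M T \<nu>' \<and> absolutely_continuous \<nu> \<nu>' \<and> sets \<nu>' = sets \<nu>"
proof -
  note a = acimD[OF \<nu>]
  interpret prob_space \<nu> by (rule a)
  define \<I> where "\<I> = {A \<in> sets m. T -` A \<inter> M = A \<and> measure \<nu> A > 0}"
  define Y where "Y \<A> \<longleftrightarrow> finite \<A> \<and> \<A> \<subseteq> \<I> \<and> disjoint \<A>" for \<A>
  have \<I>_acim: "acim M T (uniform_measure \<nu> A)" if "A \<in> \<I>" for A
  proof (rule acim_uniform_measure)
    show "finite_measure \<nu>" by unfold_locales
    show "\<And>x. x \<in> A \<Longrightarrow> T x \<in> A" using that by (auto simp: \<I>_def)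
  qed (use that a acim_vimage[OF \<nu>] in \<open>auto simp: \<I>_def\<close>)
  have um: "measure (uniform_measure \<nu> A) C = measure \<nu> (A \<inter> C) / measure \<nu> A"
    if "A \<in> \<I>" "C \<in> sets m" for A C
    using that a(2) by (intro measure_uniform_measure) (auto simp: \<I>_def emeasure_eq_measure)
  obtain N where N: "\<And>X. finite X \<Longrightarrow> \<forall>\<nu>\<in>X. acim M T \<nu> \<Longrightarrow>
    \<forall>\<nu>\<in>X. \<forall>\<nu>'\<in>X. \<nu> \<noteq> \<nu>' \<longrightarrow> (\<exists>P\<in>sets m. measure \<nu> P = 1 \<and> measure \<nu>' P = 0) \<Longrightarrow> card X \<le> N"
    using separated_acims_bounded by blast
  \<comment> \<open>The conditional measures on the members are acims, pairwise separated by the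
    members themselves.\<close>
  have bound: "card \<A> \<le> N" if Y: "Y \<A>" for \<A>
  proof -
    have fin: "finite \<A>" and sub: "\<And>A. A \<in> \<A> \<Longrightarrow> A \<in> \<I>" and dis: "disjoint \<A>"
      using Y by (auto simp: Y_def)
    have sep: "measure (uniform_measure \<nu> A) A = 1 \<and> (A \<noteq> A' \<longrightarrow> measure (uniform_measure \<nu> A') A = 0)"
      if "A \<in> \<A>" "A' \<in> \<A>" for A A'
    proof -
      have "A \<noteq> A' \<Longrightarrow> A' \<inter> A = {}" using dis that by (auto simp: disjoint_def)
      then show ?thesis using sub[OF that(1)] sub[OF that(2)] um[of A A] um[of A' A] by (auto simp: \<I>_def)
    qed
    have "inj_on (uniform_measure \<nu>) \<A>"
      by (rule inj_onI) (metis sep zero_neq_one)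
    then have "card \<A> = card (uniform_measure \<nu> ` \<A>)" by (simp add: card_image)
    also have "\<dots> \<le> N"
    proof (rule N)
      show "\<forall>\<nu>'\<in>uniform_measure \<nu> ` \<A>. acim M T \<nu>'" using sub \<I>_acim by blast
      show "\<forall>\<nu>'\<in>uniform_measure \<nu> ` \<A>. \<forall>\<nu>''\<in>uniform_measure \<nu> ` \<A>. \<nu>' \<noteq> \<nu>'' \<longrightarrow>
          (\<exists>P\<in>sets m. measure \<nu>' P = 1 \<and> measure \<nu>'' P = 0)"
        using sep sub unfolding \<I>_def by blast
    qed (use fin in simp)
    finally show ?thesis .
  qed
  have "M \<in> \<I>"
    using T_in_M prob_space sets.top[of m] a(3) by (auto simp: \<I>_def)
  then have "Y {M}" by (auto simp: Y_def disjoint_def)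
  then obtain \<A> where \<A>: "Y \<A>" "\<And>\<A>'. Y \<A>' \<Longrightarrow> card \<A>' \<le> card \<A>"
    using ex_has_greatest_nat[of Y "{M}" card "Suc N"] bound by (metis le_imp_less_Suc)
  have "card \<A> \<ge> 1" using \<A>(2)[OF \<open>Y {M}\<close>] by simp
  then obtain A where A: "A \<in> \<A>" by fastforce
  then have AI: "A \<in> \<I>" using \<A>(1) by (auto simp: Y_def)
  then have A_sets: "A \<in> sets m" and A_inv: "T -` A \<inter> M = A" and A_pos: "measure \<nu> A > 0"
    by (auto simp: \<I>_def)
  have "measure (uniform_measure \<nu> A) C \<in> {0, 1}" if C: "C \<in> sets m" "T -` C \<inter> M = C" for C
  proof (rule ccontr)
    have split: "measure \<nu> A = measure \<nu> (A \<inter> C) + measure \<nu> (A - C)"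
      using A_sets C(1) a(2) by (subst finite_measure_Union[symmetric]) (auto intro: arg_cong[where f="measure \<nu>"])
    assume "measure (uniform_measure \<nu> A) C \<notin> {0, 1}"
    then have "measure \<nu> (A \<inter> C) \<noteq> 0" "measure \<nu> (A \<inter> C) \<noteq> measure \<nu> A"
      using um[OF AI C(1)] A_pos by auto
    then have "measure \<nu> (A \<inter> C) > 0" "measure \<nu> (A - C) > 0"
      using split by (auto simp: zero_less_measure_iff)
    then have I2: "A \<inter> C \<in> \<I>" "A - C \<in> \<I>"
      using A_sets A_inv C by (auto simp: \<I>_def)
    have ne: "A \<inter> C \<noteq> {}" "A - C \<noteq> {}"
      using \<open>measure \<nu> (A \<inter> C) > 0\<close> \<open>measure \<nu> (A - C) > 0\<close> by (metis measure_empty less_irrefl)+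
    have dis: "X \<inter> A = {}" if "X \<in> \<A> - {A}" for X
      using that A \<A>(1) by (auto simp: Y_def disjoint_def)
    \<comment> \<open>If \<open>C\<close> cut \<open>A\<close> into two parts of positive measure,
      replacing \<open>A\<close> by them would enlarge the largest family by one.\<close>
    define \<A>' where "\<A>' = insert (A \<inter> C) (insert (A - C) (\<A> - {A}))"
    have "disjoint (\<A> - {A})" using \<A>(1) by (auto simp: Y_def disjoint_def)
    then have "disjoint \<A>'"
      unfolding \<A>'_def using dis by (auto simp: disjoint_def)
    then have "Y \<A>'" using \<A>(1) I2 by (auto simp: Y_def \<A>'_def)
    moreover have "card \<A>' = Suc (card \<A>)"
    proof -
      have "A - C \<notin> \<A> - {A}" "A \<inter> C \<notin> insert (A - C) (\<A> - {A})"
        using dis[of "A - C"] dis[of "A \<inter> C"] ne by blast+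
      moreover have "finite \<A>" using \<A>(1) by (simp add: Y_def)
      ultimately show ?thesis using A card_Suc_Diff1[of \<A> A] by (simp add: \<A>'_def)
    qed
    ultimately show False using \<A>(2)[of \<A>'] by simp
  qed
  then have "ergodic_acim M T (uniform_measure \<nu> A)"
    using \<I>_acim[OF AI] by (auto simp: ergodic_acim_def)
  moreover have "absolutely_continuous \<nu> (uniform_measure \<nu> A)"
    unfolding uniform_measure_def using A_sets a(2)
    by (intro absolutely_continuousI_density borel_measurable_divide_ennreal borel_measurable_indicator) auto
  ultimately show ?thesis by auto
qed

text \<open>
  A cluster point \<open>w\<close> of the averages of \<open>\<L>\<^sup>k b\<close>, with \<open>b \<in> B\<close> close to the indicator of \<open>I\<close>, is
  an invariant density of a signed measure charging \<open>I\<close>.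
\<close>

lemma inv_density_charging:
  assumes I: "I \<in> sets m" "\<And>x. x \<in> I \<Longrightarrow> T x \<in> I" "measure m I > 0"
  shows "\<exists>w. inv_density w \<and> (LINT x|m. w x * indicator I x) > 0"
proof -
  have IM: "I \<subseteq> M" using sets.sets_into_space[OF I(1)] by simp
  \<comment> \<open>A budget of four: the indicator contributes \<open>4 * \<delta>\<close>, its
    replacement by \<open>b\<close> costs one \<open>\<delta>\<close>, the passage to the cluster
    point another, and the rest stays positive.\<close>
  define \<delta> where "\<delta> = measure m I / 4"
  have \<delta>: "\<delta> > 0" using I by (simp add: \<delta>_def)
  have iI: "indicator I \<in> Linf M" by (rule indicator_Linf[OF I(1)])
  have iIL: "(indicator I :: 'a \<Rightarrow> real) \<in> L1 M"
    using I(1) unfolding L1_integrable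
    by (intro integrable_real_indicator) (simp_all add: m.emeasure_eq_measure)
  obtain b where b: "b \<in> B" "L1_norm M (\<lambda>x. b x - indicator I x) < \<delta>"
    using dense iIL \<delta> unfolding L1_dense_def by blast
  define f where "f k = (transfer_op M T ^^ k) b" for k
  have f_B: "f k \<in> B" and f_L1: "f k \<in> L1 M" and f_norm: "L1_norm M (f k) \<le> L1_norm M b" for k
    using funpow_transfer_op_B(1,2)[OF b(1), of k] B_L1 by (auto simp: f_def)
  \<comment> \<open>The iterated (LY) bound with \<open>\<eta> ^ k \<le> 1\<close>, plus the L1
    norm; the summand 1 only secures positivity.\<close>
  define K where "K = 1 + sn b + (1 + D / (1 - \<eta>)) * L1_norm M b"
  have K: "K > 0"
    using sn_nonneg[OF b(1)] \<eta> D L1_norm_nonneg[of b] by (simp add: K_def add_pos_nonneg)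
  have f_K: "B_norm M sn (f k) \<le> K" for k
  proof -
    have "\<eta> ^ k * sn b \<le> 1 * sn b"
      using \<eta> sn_nonneg[OF b(1)] by (intro mult_right_mono power_le_one) auto
    then show ?thesis
      using funpow_transfer_op_B(2,3)[OF b(1), of k]
      by (simp add: B_norm_def f_def K_def distrib_right)
  qed
  define c where "c n x = inverse (real (Suc n)) * (\<Sum>k<Suc n. f k x)" for n x
  have c_B: "c n \<in> B \<and> B_norm M sn (c n) \<le> K" for n
  proof -
    have "(\<lambda>x. \<Sum>k<Suc n. f k x) \<in> B \<and> B_norm M sn (\<lambda>x. \<Sum>k<Suc n. f k x) \<le> real (Suc n) * K"
      using f_B f_K by (intro B_norm_sum_le) auto
    then have s: "(\<lambda>x. \<Sum>k<Suc n. f k x) \<in> B" "B_norm M sn (\<lambda>x. \<Sum>k<Suc n. f k x) \<le> real (Suc n) * K"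
      by blast+
    have "B_norm M sn (c n) = inverse (real (Suc n)) * B_norm M sn (\<lambda>x. \<Sum>k<Suc n. f k x)"
      unfolding c_def using B_norm_cmult[OF s(1), of "inverse (real (Suc n))"] by simp
    also have "\<dots> \<le> inverse (real (Suc n)) * (real (Suc n) * K)"
      using s(2) by (intro mult_left_mono) auto
    also have "\<dots> = K" by simp
    finally show ?thesis using cmult_B[OF s(1), of "inverse (real (Suc n))"] by (simp add: c_def[abs_def])
  qed
  have c_L1: "c n \<in> L1 M" for n using c_B B_L1 by blast
  have c_int: "(LINT x|m. c n x * g x) = inverse (real (Suc n)) * (\<Sum>k<Suc n. LINT x|m. f k x * g x)"
    if "g \<in> Linf M" for g n
  proof -
    have "(LINT x|m. c n x * g x) = (LINT x|m. inverse (real (Suc n)) * (\<Sum>k<Suc n. f k x * g x))"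
      by (simp only: c_def sum_distrib_right mult.assoc)
    also have "\<dots> = inverse (real (Suc n)) * (LINT x|m. (\<Sum>k<Suc n. f k x * g x))"
      by (rule integral_mult_right_zero)
    also have "(LINT x|m. (\<Sum>k<Suc n. f k x * g x)) = (\<Sum>k<Suc n. LINT x|m. f k x * g x)"
      by (intro Bochner_Integration.integral_sum integrable_mult_Linf f_L1 that)
    finally show ?thesis .
  qed
  have f_Suc: "(LINT x|m. f k x * g (T x)) = (LINT x|m. f (Suc k) x * g x)" if "g \<in> Linf M" for g k
    using transfer_op_spec(2)[OF f_L1[of k] that] by (simp add: f_def)
  obtain w where w: "w \<in> L1 M" and w_all: "\<forall>r>0. \<forall>N. \<exists>n\<ge>N. L1_norm M (\<lambda>x. c n x - w x) < r"
    using cluster_point_B[OF K c_B] by (rule bexE)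
  have w_near: "\<exists>n\<ge>N. L1_norm M (\<lambda>x. c n x - w x) < r" if "r > 0" for r N
    using w_all that by simp
  have near: "\<bar>(LINT x|m. c n x * g x) - (LINT x|m. w x * g x)\<bar> \<le> C * L1_norm M (\<lambda>x. c n x - w x)"
    if "g \<in> Linf M" "AE x in m. \<bar>g x\<bar> \<le> C" for g C n
    using abs_integral_mult_le[OF L1_diff[OF c_L1[of n] w] that]
      integrable_mult_Linf[OF c_L1[of n] that(1)] integrable_mult_Linf[OF w that(1)]
    by (simp add: left_diff_distrib)
  have "(LINT x|m. w x * g (T x)) = (LINT x|m. w x * g x)" if g: "g \<in> Linf M" for g
  proof -
    obtain C0 where C0: "C0 \<ge> 0" "AE x in m. \<bar>g x\<bar> \<le> C0" by (rule Linf_bound[OF g])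
    obtain C1 where C1: "C1 \<ge> 0" "AE x in m. \<bar>g (T x)\<bar> \<le> C1" by (rule Linf_bound[OF Linf_comp_T[OF g]])
    let ?d = "\<bar>(LINT x|m. w x * g (T x)) - (LINT x|m. w x * g x)\<bar>"
    have "?d \<le> 0 + r" if r: "r > 0" for r
    proof -
      \<comment> \<open>Three errors add up to \<open>r\<close>: the telescoped difference of
        averages is at most \<open>q\<close> once \<open>n\<close> is large, and replacing the
        average by \<open>w\<close> costs \<open>C0 * q\<close> and \<open>C1 * q\<close>.\<close>
      define q where "q = r / (C0 + C1 + 1)"
      have q: "q > 0" using r C0 C1 by (simp add: q_def)
      obtain N where N: "2 * C0 * L1_norm M b / q < real N" using reals_Archimedean2 by blast
      obtain n where n: "n \<ge> N" "L1_norm M (\<lambda>x. c n x - w x) < q" using w_near[OF q] by blast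
      have "(LINT x|m. c n x * g (T x)) - (LINT x|m. c n x * g x) = inverse (real (Suc n)) *
          ((\<Sum>k<Suc n. LINT x|m. f (Suc k) x * g x) - (\<Sum>k<Suc n. LINT x|m. f k x * g x))"
        using c_int[OF g] c_int[OF Linf_comp_T[OF g]] f_Suc[OF g]
        by (simp only: right_diff_distrib)
      also have "(\<Sum>k<Suc n. LINT x|m. f (Suc k) x * g x) - (\<Sum>k<Suc n. LINT x|m. f k x * g x)
          = (LINT x|m. f (Suc n) x * g x) - (LINT x|m. f 0 x * g x)"
        unfolding sum_subtractf[symmetric] by (rule sum_lessThan_telescope)
      finally have e: "\<bar>(LINT x|m. c n x * g (T x)) - (LINT x|m. c n x * g x)\<bar> =
          inverse (real (Suc n)) * \<bar>(LINT x|m. f (Suc n) x * g x) - (LINT x|m. f 0 x * g x)\<bar>"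
        by (simp add: abs_mult)
      have fb: "\<bar>LINT x|m. f k x * g x\<bar> \<le> C0 * L1_norm M b" for k
        using abs_integral_mult_le[OF f_L1[of k] g C0(2)] mult_left_mono[OF f_norm[of k] C0(1)] by linarith
      have "\<bar>(LINT x|m. f (Suc n) x * g x) - (LINT x|m. f 0 x * g x)\<bar> \<le> 2 * C0 * L1_norm M b"
        using fb[of "Suc n"] fb[of 0] by linarith
      also have "\<dots> \<le> real (Suc n) * q"
      proof -
        have "2 * C0 * L1_norm M b < real N * q" using N q by (simp add: field_simps)
        also have "\<dots> \<le> real (Suc n) * q" using n(1) q by (intro mult_right_mono) auto
        finally show ?thesis by simp
      qed
      finally have "\<bar>(LINT x|m. c n x * g (T x)) - (LINT x|m. c n x * g x)\<bar> \<le> q"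
        unfolding e using q by (simp add: field_simps)
      moreover have "\<bar>(LINT x|m. c n x * g x) - (LINT x|m. w x * g x)\<bar> \<le> C0 * q"
        using near[OF g C0(2), of n] mult_left_mono[OF less_imp_le[OF n(2)] C0(1)] by linarith
      moreover have "\<bar>(LINT x|m. c n x * g (T x)) - (LINT x|m. w x * g (T x))\<bar> \<le> C1 * q"
        using near[OF Linf_comp_T[OF g] C1(2), of n] mult_left_mono[OF less_imp_le[OF n(2)] C1(1)] by linarith
      ultimately have "?d \<le> q + C0 * q + C1 * q" by linarith
      also have "\<dots> = (C0 + C1 + 1) * q" by (simp add: algebra_simps)
      also have "\<dots> = r" using C0 C1 by (simp add: q_def)
      finally show ?thesis by simp
    qed
    then have "?d \<le> 0" by (rule field_le_epsilon)
    then show ?thesis by simp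
  qed
  then have inv: "inv_density w" using w by (simp add: inv_density_def)
  \<comment> \<open>By duality the integral is that of \<open>b\<close> against the indicator of
    \<open>I\<close> composed with the \<open>k\<close>-th iterate. Forward invariance makes this
    composite equal to 1 on \<open>I\<close>, so for the indicator in place of \<open>b\<close> the
    value is the measure of \<open>I\<close>, uniformly in \<open>k\<close>.\<close>
  have f_I: "(LINT x|m. f k x * indicator I x) \<ge> 3 * \<delta>" for k
  proof -
    have Lk: "(LINT x|m. f k x * g x) = (LINT x|m. b x * g ((T ^^ k) x)) \<and> (\<lambda>x. g ((T ^^ k) x)) \<in> Linf M"
      if "g \<in> Linf M" for g
      using that
    proof (induction k arbitrary: g)
      case (Suc k)
      then show ?case using Suc.IH[OF Linf_comp_T[OF Suc.prems]] f_Suc[OF Suc.prems] by simp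
    qed (simp add: f_def)
    let ?g = "\<lambda>x. indicator I ((T ^^ k) x) :: real"
    have g: "?g \<in> Linf M" using Lk[OF iI] by blast
    have g1: "AE x in m. \<bar>?g x\<bar> \<le> 1" by (rule AE_I2) (simp add: indicator_def)
    have TkI: "(T ^^ k) x \<in> I" if "x \<in> I" for x
      by (induction k) (use that I(2) in auto)
    have "(LINT x|m. indicator I x * ?g x) = (LINT x|m. indicator I x)"
      using TkI by (intro Bochner_Integration.integral_cong) (auto simp: indicator_def)
    also have "\<dots> = measure m I" using I(1) IM by (simp add: Int_absorb2)
    also have "\<dots> = 4 * \<delta>" by (simp add: \<delta>_def)
    finally have "(LINT x|m. indicator I x * ?g x) = 4 * \<delta>" .
    moreover have "\<bar>(LINT x|m. b x * ?g x) - (LINT x|m. indicator I x * ?g x)\<bar>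
        \<le> 1 * L1_norm M (\<lambda>x. b x - indicator I x)"
      using abs_integral_mult_le[OF L1_diff[OF B_L1[OF b(1)] iIL] g g1]
        integrable_mult_Linf[OF B_L1[OF b(1)] g] integrable_mult_Linf[OF iIL g]
      by (simp add: left_diff_distrib)
    ultimately show ?thesis using Lk[OF iI] b(2) by linarith
  qed
  obtain n where n: "L1_norm M (\<lambda>x. c n x - w x) < \<delta>" using w_near[OF \<delta>, of 0] by blast
  have "(LINT x|m. c n x * indicator I x) \<ge> 3 * \<delta>"
  proof -
    have "(\<Sum>k<Suc n. 3 * \<delta>) \<le> (\<Sum>k<Suc n. LINT x|m. f k x * indicator I x)"
      by (intro sum_mono f_I)
    then have "real (Suc n) * (3 * \<delta>) \<le> (\<Sum>k<Suc n. LINT x|m. f k x * indicator I x)" by simp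
    then have "inverse (real (Suc n)) * (real (Suc n) * (3 * \<delta>)) \<le>
        inverse (real (Suc n)) * (\<Sum>k<Suc n. LINT x|m. f k x * indicator I x)"
      by (intro mult_left_mono) auto
    moreover have "inverse (real (Suc n)) * (real (Suc n) * (3 * \<delta>)) = 3 * \<delta>"
      by (simp only: mult.assoc[symmetric]) simp
    ultimately show ?thesis unfolding c_int[OF iI] by (simp only:)
  qed
  moreover have "AE x in m. \<bar>indicator I x :: real\<bar> \<le> 1" by (rule AE_I2) (simp add: indicator_def)
  ultimately have "(LINT x|m. w x * indicator I x) > 0"
    using near[OF iI, of 1 n] n \<delta> by linarith
  then show ?thesis using inv by blast
qed

text \<open>The acim carried by \<open>I\<close> need not be ergodic; an ergodic component is
  absolutely continuous with respect to it, so it inherits being carried by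
  \<open>I\<close>.\<close>

lemma ergodic_acim_in_forward_invariant:
  assumes I: "I \<in> sets m" "\<And>x. x \<in> I \<Longrightarrow> T x \<in> I" "measure m I > 0"
  shows "\<exists>\<nu>. ergodic_acim M T \<nu> \<and> (AE x in \<nu>. x \<in> I)"
proof -
  obtain w where w: "inv_density w" "(LINT x|m. w x * indicator I x) > 0"
    using inv_density_charging[OF I] by blast
  obtain \<nu> where \<nu>: "acim M T \<nu>" "AE x in \<nu>. x \<in> I"
    using acim_from_signed_density[OF w(1) I(1,2) w(2)] by blast
  obtain \<nu>' where \<nu>': "ergodic_acim M T \<nu>'" "absolutely_continuous \<nu> \<nu>'" "sets \<nu>' = sets \<nu>"
    using ergodic_component[OF \<nu>(1)] by blast
  have "AE x in \<nu>'. x \<in> I" using absolutely_continuous_AE[OF _ \<nu>'(2) \<nu>(2)] \<nu>'(3) by simp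
  then show ?thesis using \<nu>'(1) by blast
qed

subsection \<open>Least elements\<close>

lemma equiv_support_equiv: "equiv (ergodic_supports M T) (support_equiv M T)"
proof (rule equivI)
  show "support_equiv M T \<subseteq> ergodic_supports M T \<times> ergodic_supports M T"
    by (auto simp: support_equiv_def)
  show "refl_on (ergodic_supports M T) (support_equiv M T)"
    by (auto simp: refl_on_def support_equiv_def leads_to_refl)
  show "sym (support_equiv M T)" by (auto simp: sym_def support_equiv_def)
  show "trans (support_equiv M T)"
    unfolding trans_def support_equiv_def using leads_to_trans by blast
qed

lemma support_classesE:
  assumes "C \<in> support_classes M T"
  obtains \<Lambda> where "\<Lambda> \<in> ergodic_supports M T" "C = support_equiv M T `` {\<Lambda>}" "\<Lambda> \<in> C"
  using assms equiv_class_self[OF equiv_support_equiv]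
  unfolding support_classes_def by (metis quotientE)

lemma class_leads_to_iff:
  assumes \<Lambda>: "\<Lambda> \<in> ergodic_supports M T" and \<Lambda>': "\<Lambda>' \<in> ergodic_supports M T"
  shows "class_leads_to M T (support_equiv M T `` {\<Lambda>}) (support_equiv M T `` {\<Lambda>'}) \<longleftrightarrow> leads_to M T \<Lambda> \<Lambda>'"
proof
  assume "class_leads_to M T (support_equiv M T `` {\<Lambda>}) (support_equiv M T `` {\<Lambda>'})"
  then show "leads_to M T \<Lambda> \<Lambda>'"
    using equiv_class_self[OF equiv_support_equiv] \<Lambda> \<Lambda>' by (auto simp: class_leads_to_def)
next
  assume lt: "leads_to M T \<Lambda> \<Lambda>'"
  show "class_leads_to M T (support_equiv M T `` {\<Lambda>}) (support_equiv M T `` {\<Lambda>'})"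
    unfolding class_leads_to_def
  proof (intro ballI)
    fix X X' assume "X \<in> support_equiv M T `` {\<Lambda>}" "X' \<in> support_equiv M T `` {\<Lambda>'}"
    then have X: "X \<in> ergodic_supports M T" "leads_to M T X \<Lambda>"
      and X': "X' \<in> ergodic_supports M T" "leads_to M T \<Lambda>' X'"
      by (auto simp: support_equiv_def)
    show "leads_to M T X X'"
      using leads_to_trans[OF X(1) \<Lambda> X(2) lt] leads_to_trans[OF X(1) \<Lambda>' _ X'(2)] by blast
  qed
qed

text \<open>Among the supports reachable from \<open>\<Lambda>\<close>, take \<open>X\<close>
  reaching the fewest. Whatever \<open>X\<close> leads to reaches no more than \<open>X\<close>
  does, hence by minimality equally much, in particular \<open>X\<close> itself; so it belongs to
  the class of \<open>X\<close>.\<close>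

lemma least_element_reachable:
  assumes \<Lambda>: "\<Lambda> \<in> ergodic_supports M T"
  shows "\<exists>C. least_element M T C \<and> (\<forall>\<Lambda>'\<in>C. \<Lambda>' \<in> ergodic_supports M T \<and> leads_to M T \<Lambda> \<Lambda>')"
proof -
  define R where "R X = {Y \<in> ergodic_supports M T. leads_to M T X Y}" for X
  have fin: "finite (R X)" for X using finite_ergodic_supports by (simp add: R_def)
  have "\<Lambda> \<in> R \<Lambda>" using \<Lambda> leads_to_refl by (simp add: R_def)
  then obtain X where X: "X \<in> R \<Lambda>" "\<And>Y. Y \<in> R \<Lambda> \<Longrightarrow> card (R X) \<le> card (R Y)"
    using ex_has_least_nat[of "\<lambda>X. X \<in> R \<Lambda>" \<Lambda> "\<lambda>X. card (R X)"] by blast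
  have XE: "X \<in> ergodic_supports M T" and X\<Lambda>: "leads_to M T \<Lambda> X" using X(1) by (auto simp: R_def)
  define C where "C = support_equiv M T `` {X}"
  have "least_element M T C"
    unfolding least_element_def
  proof (intro conjI notI)
    show "C \<in> support_classes M T" using XE by (simp add: C_def support_classes_def quotientI)
    assume "\<exists>C'\<in>support_classes M T. C' \<noteq> C \<and> class_leads_to M T C C'"
    then obtain C' where C': "C' \<in> support_classes M T" "C' \<noteq> C" "class_leads_to M T C C'" by blast
    obtain Y where Y: "Y \<in> ergodic_supports M T" "C' = support_equiv M T `` {Y}"
      using support_classesE[OF C'(1)] by blast
    have XY: "leads_to M T X Y" using C'(3) class_leads_to_iff[OF XE Y(1)] by (simp add: C_def Y(2))
    then have "Y \<in> R \<Lambda>" using leads_to_trans[OF \<Lambda> XE X\<Lambda>] Y(1) by (simp add: R_def)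
    moreover have sub: "R Y \<subseteq> R X"
      unfolding R_def using leads_to_trans[OF XE Y(1) XY] by blast
    ultimately have "R Y = R X" using X(2)[of Y] card_seteq[OF fin sub] by blast
    then have "leads_to M T Y X" using leads_to_refl[OF XE] XE by (auto simp: R_def)
    then have "(X, Y) \<in> support_equiv M T" using XY XE Y(1) by (simp add: support_equiv_def)
    then show False using C'(2) Y(2) equiv_class_eq[OF equiv_support_equiv] by (auto simp: C_def)
  qed
  moreover have "\<Lambda>' \<in> ergodic_supports M T \<and> leads_to M T \<Lambda> \<Lambda>'" if "\<Lambda>' \<in> C" for \<Lambda>'
    using that leads_to_trans[OF \<Lambda> XE X\<Lambda>] by (auto simp: C_def support_equiv_def)
  ultimately show ?thesis by blast
qed

lemma eps_step_mono_rtranclp: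
  assumes "(eps_step M T e)\<^sup>*\<^sup>* x y" "e \<le> e'"
  shows "(eps_step M T e')\<^sup>*\<^sup>* x y"
  using assms(1) by (rule rtranclp_mono[THEN predicate2D, rotated]) (use assms(2) eps_step_mono in blast)

text \<open>If \<open>\<Lambda>\<close> does not lead to \<open>\<Lambda>'\<close>, some scale
  admits no chain, and then no smaller scale does. Finitely many pairs leave a positive minimum; the
  inserted 1 keeps the set nonempty.\<close>

lemma leads_to_threshold:
  "\<exists>e0>0. \<forall>\<Lambda>\<in>ergodic_supports M T. \<forall>\<Lambda>'\<in>ergodic_supports M T. \<forall>x\<in>\<Lambda>. \<forall>y\<in>\<Lambda>'.
     (eps_step M T e0)\<^sup>*\<^sup>* x y \<longrightarrow> leads_to M T \<Lambda> \<Lambda>'"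
proof -
  let ?E = "ergodic_supports M T"
  have "\<exists>e>0. leads_to M T \<Lambda> \<Lambda>' \<or> (\<forall>x\<in>\<Lambda>. \<forall>y\<in>\<Lambda>'. \<not> (eps_step M T e)\<^sup>*\<^sup>* x y)"
    if "\<Lambda> \<in> ?E" for \<Lambda> \<Lambda>'
    using ergodic_support_subset_M[OF that] unfolding leads_to_iff_rtranclp by (meson IntI subsetD zero_less_one)
  then obtain e where e: "\<And>\<Lambda> \<Lambda>'. \<Lambda> \<in> ?E \<Longrightarrow> e \<Lambda> \<Lambda>' > 0"
    "\<And>\<Lambda> \<Lambda>' x y. \<Lambda> \<in> ?E \<Longrightarrow> x \<in> \<Lambda> \<Longrightarrow> y \<in> \<Lambda>' \<Longrightarrow> (eps_step M T (e \<Lambda> \<Lambda>'))\<^sup>*\<^sup>* x y \<Longrightarrow> leads_to M T \<Lambda> \<Lambda>'"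
    by metis
  define e0 where "e0 = Min (insert 1 ((\<lambda>(\<Lambda>, \<Lambda>'). e \<Lambda> \<Lambda>') ` (?E \<times> ?E)))"
  have fin: "finite (insert 1 ((\<lambda>(\<Lambda>, \<Lambda>'). e \<Lambda> \<Lambda>') ` (?E \<times> ?E)))"
    using finite_ergodic_supports by simp
  have "e0 > 0" unfolding e0_def using fin e(1) by (subst Min_gr_iff) auto
  moreover have "leads_to M T \<Lambda> \<Lambda>'"
    if "\<Lambda> \<in> ?E" "\<Lambda>' \<in> ?E" "x \<in> \<Lambda>" "y \<in> \<Lambda>'" "(eps_step M T e0)\<^sup>*\<^sup>* x y" for \<Lambda> \<Lambda>' x y
  proof -
    have "e0 \<le> e \<Lambda> \<Lambda>'" unfolding e0_def using fin that by (intro Min_le) auto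
    then show ?thesis using e(2)[OF that(1,3,4)] eps_step_mono_rtranclp[OF that(5)] by blast
  qed
  ultimately show ?thesis by blast
qed

end

subsection \<open>The support of an ergodic stationary measure\<close>

locale random_perturbation = nonsingular_system M T
  for M :: "'a::euclidean_space set" and T +
  fixes Q :: "'a \<Rightarrow> 'a measure" and q :: "'a \<Rightarrow> 'a \<Rightarrow> real" and \<epsilon> :: real and \<mu> :: "'a measure"
  assumes \<epsilon>: "\<epsilon> > 0"
    and limit_values: "limit_values M T"
    and kernel: "Q \<in> m \<rightarrow>\<^sub>M prob_algebra m"
    and q_density: "\<And>x. x \<in> M \<Longrightarrow> q x \<in> borel_measurable m \<and> Q x = density m (\<lambda>y. ennreal (q x y))"
    and q_pos: "\<And>x y. x \<in> M \<Longrightarrow> y \<in> relball M \<epsilon> (T x) \<Longrightarrow> q x y > 0"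
    and Q_outside: "\<And>x. x \<in> M \<Longrightarrow> emeasure (Q x) (M - relball M \<epsilon> (T x)) = 0"
    and ergodic: "ergodic_acsm M Q \<mu>"
begin

abbreviation "S \<equiv> measure_support \<mu>"

lemma prob_\<mu>: "prob_space \<mu>" and sets_\<mu>: "sets \<mu> = sets m"
  and stationary: "A \<in> sets m \<Longrightarrow> emeasure \<mu> A = (\<integral>\<^sup>+x. emeasure (Q x) A \<partial>\<mu>)"
  using ergodic by (auto simp: ergodic_acsm_def acsm_def stationary_def)

sublocale \<mu>: prob_space \<mu> by (rule prob_\<mu>)

lemma space_\<mu>: "space \<mu> = M"
  using sets_eq_imp_space_eq[OF sets_\<mu>] by simp

lemma Q_space: "x \<in> M \<Longrightarrow> Q x \<in> space (prob_algebra m)"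
  using measurable_space[OF kernel] by simp

lemma Q_sets: "x \<in> M \<Longrightarrow> sets (Q x) = sets m"
  using Q_space by (simp add: space_prob_algebra)

lemma Q_prob: "x \<in> M \<Longrightarrow> prob_space (Q x)"
  using Q_space by (simp add: space_prob_algebra)

lemma emeasure_Q_measurable: "A \<in> sets m \<Longrightarrow> (\<lambda>x. emeasure (Q x) A) \<in> borel_measurable \<mu>"
  using measurable_emeasure_kernel[OF measurable_prob_algebraD[OF kernel], of A] sets_\<mu> measurable_cong_sets by blast

lemma relball_eq: "relball M \<epsilon> x = ball x \<epsilon> \<inter> M"
  by (auto simp: relball_def)

lemma relball_sets: "relball M \<epsilon> x \<in> sets m"
  unfolding relball_eq by (rule open_Int_sets_m) simp

lemma support_sets: "S \<in> sets m"
  using closed_closure[of S] borel_closed support_subset_M[OF sets_\<mu>]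
  by (metis closure_support[OF sets_\<mu>] sets_m_iff)

lemma closed_support: "closed S"
  by (metis closed_closure closure_support[OF sets_\<mu>])

text \<open>Stationarity applied to the null set \<open>M - S\<close> shows that almost every
  \<open>Q x\<close> ignores it. A point of the ball outside the closed set \<open>S\<close> would
  have a relative neighbourhood of positive Lebesgue measure on which the density \<open>q x\<close>
  is positive.\<close>

lemma AE_relball_subset: "AE x in \<mu>. relball M \<epsilon> (T x) \<subseteq> S"
proof -
  have cS: "M - S \<in> sets m" using sets.compl_sets[OF support_sets] by simp
  have "emeasure \<mu> (M - S) = 0"
    using AE_support[OF sets_\<mu>] cS
    by (intro iffD1[OF AE_iff_measurable[of "M - S" \<mu> "\<lambda>x. x \<in> S"]]) (auto simp: sets_\<mu> space_\<mu>)
  then have "AE x in \<mu>. emeasure (Q x) (M - S) = 0"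
    using stationary[OF cS] nn_integral_0_iff_AE[OF emeasure_Q_measurable[OF cS]] by simp
  moreover have "AE x in \<mu>. x \<in> M" using AE_space[of \<mu>] by (simp add: space_\<mu>)
  ultimately show ?thesis
  proof eventually_elim
    fix x assume 0: "emeasure (Q x) (M - S) = 0" and x: "x \<in> M"
    show "relball M \<epsilon> (T x) \<subseteq> S"
    proof (rule ccontr)
      assume "\<not> ?thesis"
      then obtain y where y: "y \<in> relball M \<epsilon> (T x)" "y \<notin> S" by blast
      define U where "U = ball (T x) \<epsilon> \<inter> - S"
      have U: "open U" "y \<in> U" "y \<in> M"
        using y closed_support by (auto simp: U_def relball_eq)
      have qm: "q x \<in> borel_measurable m" "Q x = density m (\<lambda>y. ennreal (q x y))"
        using q_density[OF x] by auto
      have "AE z in density m (\<lambda>y. ennreal (q x y)). z \<notin> M - S"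
        unfolding qm(2)[symmetric] using 0 cS Q_sets[OF x] by (intro AE_not_in) (simp add: null_sets_def)
      then have "AE z in m. 0 < ennreal (q x z) \<longrightarrow> z \<notin> M - S"
        by (rule iffD1[OF AE_density, rotated]) (use qm(1) in simp)
      moreover have "AE z in m. z \<in> M" using AE_space[of m] by simp
      ultimately have "AE z in m. z \<notin> U \<inter> M"
        by eventually_elim (use q_pos[OF x] in \<open>auto simp: U_def relball_eq\<close>)
      then have "emeasure m (U \<inter> M) = 0"
        using open_Int_sets_m[OF U(1)]
        by (intro iffD1[OF AE_iff_measurable[of "U \<inter> M" m "\<lambda>z. z \<notin> U \<inter> M"]]) auto
      then show False using emeasure_m_open_pos[OF U] by simp
    qed
  qed
qed

section \<open>The interior of the support relative to \<open>M\<close>\<close>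

definition core :: "'a set" where
  "core = {x \<in> M. \<exists>U. open U \<and> x \<in> U \<and> U \<inter> M \<subseteq> S}"

lemma core_subset: "core \<subseteq> S" "core \<subseteq> M"
  by (auto simp: core_def)

lemma core_eq: "core = \<Union>{U. open U \<and> U \<inter> M \<subseteq> S} \<inter> M"
  by (auto simp: core_def)

lemma core_sets: "core \<in> sets m"
  unfolding core_eq by (rule open_Int_sets_m) blast

lemma coreI: "open U \<Longrightarrow> x \<in> U \<Longrightarrow> x \<in> M \<Longrightarrow> U \<inter> M \<subseteq> S \<Longrightarrow> x \<in> core"
  by (auto simp: core_def)

text \<open>
  Almost every point of the support has the following property; it propagates to all points of
  the core, since by \<open>limit_values\<close> the value of \<open>T\<close> at any point is approximated on open sets.
\<close>

lemma relball_core: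
  assumes x: "x \<in> core"
  shows "relball M \<epsilon> (T x) \<subseteq> S"
proof
  fix y assume "y \<in> relball M \<epsilon> (T x)"
  then have y: "y \<in> M" "dist (T x) y < \<epsilon>" by (auto simp: relball_def)
  obtain V where V: "open V" "x \<in> V" "V \<inter> M \<subseteq> S" and xM: "x \<in> M" using x by (auto simp: core_def)
  \<comment> \<open>\<open>x\<close> is exchanged for a nearby point of continuity whose image is
    still within \<open>\<epsilon>\<close> of \<open>y\<close>; at a discontinuity this is what
    \<open>limit_values\<close> provides.\<close>
  have "\<exists>z\<in>V \<inter> M. continuous (at z within M) T \<and> dist (T z) y < \<epsilon>"
  proof (cases "x \<in> discontinuities M T")
    case False
    then show ?thesis using V xM y by (auto simp: discontinuities_def)
  next
    case True
    then obtain z :: "nat \<Rightarrow> 'a" where z: "\<And>n. z n \<in> M - discontinuities M T" "z \<longlonglongrightarrow> x" "(\<lambda>n. T (z n)) \<longlonglongrightarrow> T x"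
      using limit_values by (auto simp: limit_values_def)
    have "eventually (\<lambda>n. z n \<in> V) sequentially" using z(2) V(1,2) by (rule topological_tendstoD)
    moreover have "eventually (\<lambda>n. T (z n) \<in> ball y \<epsilon>) sequentially"
      using z(3) by (rule topological_tendstoD) (use y in \<open>auto simp: dist_commute\<close>)
    ultimately have "eventually (\<lambda>n. z n \<in> V \<and> T (z n) \<in> ball y \<epsilon>) sequentially" by eventually_elim blast
    then obtain n where "z n \<in> V" "T (z n) \<in> ball y \<epsilon>" by (auto simp: eventually_sequentially)
    then show ?thesis using z(1)[of n] by (intro bexI[of _ "z n"]) (auto simp: discontinuities_def dist_commute)
  qed
  then obtain z where z: "z \<in> V" "z \<in> M" "continuous (at z within M) T" "dist (T z) y < \<epsilon>" by blast
  \<comment> \<open>Continuity keeps \<open>y\<close> in the ball around the image of every point of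
    \<open>M\<close> near \<open>z\<close>; since \<open>z\<close> is a support point, one of those
    points has the almost sure property.\<close>
  have "T z \<in> ball y \<epsilon>" using z(4) by (simp add: dist_commute)
  then obtain W where W: "open W" "z \<in> W" "\<And>z'. z' \<in> W \<Longrightarrow> z' \<in> M \<Longrightarrow> T z' \<in> ball y \<epsilon>"
    using z(2,3) unfolding continuous_within_topological by (metis open_ball)
  have zS: "z \<in> S" using z V(3) by blast
  have "open (V \<inter> W)" "z \<in> V \<inter> W" using V(1) W z by auto
  then obtain z' where "z' \<in> V \<inter> W \<inter> M" "relball M \<epsilon> (T z') \<subseteq> S"
    using support_witness[OF sets_\<mu> zS _ _ AE_relball_subset] by blast
  moreover have "y \<in> relball M \<epsilon> (T z')" using calculation(1) W(3)[of z'] y(1) by (auto simp: relball_def dist_commute)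
  ultimately show "y \<in> S" by blast
qed

text \<open>The ball around \<open>T x\<close> is relatively open, so lying in \<open>S\<close> it
  lies in the interior.\<close>

lemma eps_step_core: "x \<in> core \<Longrightarrow> eps_step M T \<epsilon> x y \<Longrightarrow> y \<in> core"
  using relball_core[of x] by (intro coreI[of "ball (T x) \<epsilon>"]) (auto simp: eps_step_def relball_eq)

lemma rtranclp_eps_step_core:
  assumes "(eps_step M T \<epsilon>)\<^sup>*\<^sup>* x y" "x \<in> core"
  shows "y \<in> core"
  using assms by (induction) (auto intro: eps_step_core)

lemma T_core: "x \<in> core \<Longrightarrow> T x \<in> core"
  by (rule eps_step_core) (use core_subset T_in_M \<epsilon> in \<open>auto simp: eps_step_def\<close>)

text \<open>A single point with the almost sure inclusion suffices: the ball around its image is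
  relatively open, lies in \<open>S\<close>, and has positive measure.\<close>

lemma core_pos: "measure m core > 0"
proof -
  have "AE x in \<mu>. x \<in> M" using AE_space[of \<mu>] by (simp add: space_\<mu>)
  with AE_relball_subset have "AE x in \<mu>. x \<in> M \<and> relball M \<epsilon> (T x) \<subseteq> S"
    by eventually_elim simp
  then obtain x where x: "x \<in> M" "relball M \<epsilon> (T x) \<subseteq> S"
    using eventually_happens'[OF \<mu>.ae_filter_bot] by blast
  have "ball (T x) \<epsilon> \<inter> M \<subseteq> core"
    using x by (auto intro!: coreI[of "ball (T x) \<epsilon>"] simp: relball_eq)
  then have "emeasure m (ball (T x) \<epsilon> \<inter> M) \<le> emeasure m core"
    using core_sets by (rule emeasure_mono)
  moreover have "emeasure m (ball (T x) \<epsilon> \<inter> M) > 0"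
    using x T_in_M \<epsilon> by (intro emeasure_m_open_pos[of _ "T x"]) auto
  ultimately show ?thesis by (simp add: m.emeasure_eq_measure)
qed

text \<open>Every point of the support, generic or not, is within \<open>\<epsilon>\<close> of the
  image of a generic point of \<open>core\<close>, and such a step does not leave
  \<open>core\<close>.\<close>

lemma ergodic_support_in_core:
  assumes \<nu>: "ergodic_acim M T \<nu>" and core: "AE x in \<nu>. x \<in> core"
  shows "measure_support \<nu> \<subseteq> core"
proof
  have a: "acim M T \<nu>" using \<nu> by (simp add: ergodic_acim_def)
  fix y assume y: "y \<in> measure_support \<nu>"
  have yM: "y \<in> M" using y support_subset_M[OF acimD(2)[OF a]] by blast
  obtain z where "z \<in> core" "T z \<in> ball y \<epsilon>"
    using support_preimage_witness[OF a y _ _ core, of "ball y \<epsilon>"] \<epsilon> by auto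
  then have "eps_step M T \<epsilon> z y"
    using yM subsetD[OF core_subset(2), of z] by (simp add: eps_step_def dist_commute)
  then show "y \<in> core" using \<open>z \<in> core\<close> by (rule eps_step_core[rotated])
qed

text \<open>A neighbourhood of \<open>y\<close> gives \<open>core\<close> positive measure for
  \<open>\<nu>\<close>; forward invariance and ergodicity raise it to 1, and closedness of
  \<open>S\<close> takes care of the remaining points.\<close>

lemma ergodic_support_meets_core:
  assumes \<nu>: "ergodic_acim M T \<nu>" and y: "y \<in> measure_support \<nu>" "y \<in> core"
  shows "measure_support \<nu> \<subseteq> S"
proof -
  have a: "acim M T \<nu>" using \<nu> by (simp add: ergodic_acim_def)
  note s = acimD[OF a]
  obtain U where U: "open U" "y \<in> U" "U \<inter> M \<subseteq> S" using y(2) by (auto simp: core_def)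
  then have "U \<inter> M \<subseteq> core" by (auto intro: coreI)
  then have "emeasure \<nu> (U \<inter> M) \<le> emeasure \<nu> core"
    using core_sets s by (intro emeasure_mono) auto
  moreover have "emeasure \<nu> (U \<inter> M) > 0" using y(1) U s by (auto simp: measure_support_def)
  ultimately have pos: "emeasure \<nu> core > 0" by simp
  interpret \<nu>: prob_space \<nu> by (rule s)
  have "measure \<nu> core \<in> {0, 1}"
    by (rule ergodic_forward_invariant[OF \<nu> core_sets]) (simp add: T_core)
  then have "measure \<nu> core = 1" using pos by (auto simp: \<nu>.emeasure_eq_measure)
  then have "AE x in \<nu>. x \<in> core" using \<nu>.prob_eq_1[of core] core_sets s by simp
  then have "AE x in \<nu>. x \<in> S" by eventually_elim (use core_subset in blast)
  then show ?thesis by (rule support_subset_closed[OF s(2) closed_support])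
qed

lemma leads_to_subset_support:
  assumes "\<Lambda> \<subseteq> core" "\<Lambda>' \<in> ergodic_supports M T" "leads_to M T \<Lambda> \<Lambda>'"
  shows "\<Lambda>' \<subseteq> S"
proof -
  obtain x y where "x \<in> \<Lambda>" "y \<in> \<Lambda>'" "(eps_step M T \<epsilon>)\<^sup>*\<^sup>* x y"
    using assms(3) \<epsilon> by (auto simp: leads_to_iff_rtranclp)
  then have "y \<in> core" using rtranclp_eps_step_core assms(1) by blast
  moreover obtain \<nu> where "\<Lambda>' = measure_support \<nu>" "ergodic_acim M T \<nu>"
    using ergodic_supportsE[OF assms(2)] by metis
  ultimately show ?thesis using \<open>y \<in> \<Lambda>'\<close> ergodic_support_meets_core by simp
qed

text \<open>
  The set \<open>R\<close> of points that \<open>\<epsilon>\<close>-pseudo-orbits reach from \<open>\<Lambda>\<close> is absorbing for the Markov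
  chain and relatively open, so by ergodicity it has full measure.
\<close>

lemma eps_chain_between:
  assumes \<Lambda>: "\<Lambda> \<in> ergodic_supports M T" "\<Lambda> \<subseteq> S" and y: "y \<in> S" and e: "\<epsilon> < e"
  shows "\<exists>x\<in>\<Lambda>. (eps_step M T e)\<^sup>*\<^sup>* x y"
proof -
  \<comment> \<open>Demanding at least one step makes \<open>R\<close> a union of relative balls. It
    still contains \<open>\<Lambda>\<close>, whose points all have predecessors in
    \<open>\<Lambda>\<close>.\<close>
  define R where "R = {y. \<exists>x\<in>\<Lambda>. (eps_step M T \<epsilon>)\<^sup>+\<^sup>+ x y}"
  have R_step: "z \<in> R" if "w \<in> R" "eps_step M T \<epsilon> w z" for w z
    using that unfolding R_def by (blast intro: tranclp.trancl_into_trancl)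
  have pre: "\<exists>w\<in>M. (w \<in> R \<or> w \<in> \<Lambda>) \<and> dist (T w) z < \<epsilon>" if "z \<in> R" for z
  proof -
    obtain x where x: "x \<in> \<Lambda>" "(eps_step M T \<epsilon>)\<^sup>+\<^sup>+ x z" using \<open>z \<in> R\<close> by (auto simp: R_def)
    from x(2) show ?thesis
    proof cases
      case r_into_trancl
      then show ?thesis using x(1) by (auto simp: eps_step_def)
    next
      case (trancl_into_trancl w)
      then show ?thesis using x(1) by (intro bexI[of _ w]) (auto simp: eps_step_def R_def)
    qed
  qed
  have \<Lambda>_step: "z \<in> R" if "w \<in> \<Lambda>" "eps_step M T \<epsilon> w z" for w z
    using that unfolding R_def by blast
  have RM: "R \<subseteq> M"
  proof
    fix z assume "z \<in> R"
    then obtain x where "(eps_step M T \<epsilon>)\<^sup>+\<^sup>+ x z" by (auto simp: R_def)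
    then show "z \<in> M" by cases (auto simp: eps_step_def)
  qed
  define U where "U = (\<Union>w\<in>M \<inter> (R \<union> \<Lambda>). ball (T w) \<epsilon>)"
  have "open U" by (auto simp: U_def)
  have R_eq: "R = U \<inter> M"
  proof (intro equalityI subsetI)
    fix z assume "z \<in> R"
    with pre[of z] show "z \<in> U \<inter> M" using RM by (auto simp: U_def)
  next
    fix z assume "z \<in> U \<inter> M"
    then obtain w where "w \<in> R \<union> \<Lambda>" "eps_step M T \<epsilon> w z" by (auto simp: U_def eps_step_def)
    then show "z \<in> R" using R_step \<Lambda>_step by blast
  qed
  then have R_sets: "R \<in> sets m" using \<open>open U\<close> by (simp add: open_Int_sets_m)
  have \<Lambda>R: "\<Lambda> \<subseteq> R"
    using ergodic_support_predecessor[OF \<Lambda>(1) _ \<epsilon>] \<Lambda>_step by blast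
  have QR: "emeasure (Q x) R = 1" if x: "x \<in> R" for x
  proof -
    have xM: "x \<in> M" using x RM by blast
    interpret Qx: prob_space "Q x" by (rule Q_prob[OF xM])
    have "relball M \<epsilon> (T x) \<subseteq> R" using R_step[OF x] xM by (auto simp: eps_step_def relball_def)
    then have "emeasure (Q x) (M - R) \<le> emeasure (Q x) (M - relball M \<epsilon> (T x))"
      using sets.compl_sets[OF relball_sets] Q_sets[OF xM] by (intro emeasure_mono) auto
    then have "emeasure (Q x) (M - R) = 0" using Q_outside[OF xM] by simp
    moreover have "space (Q x) = M" using sets_eq_imp_space_eq[OF Q_sets[OF xM]] by simp
    ultimately show ?thesis
      using Qx.prob_compl[of R] R_sets Q_sets[OF xM] by (simp add: Qx.emeasure_eq_measure)
  qed
  \<comment> \<open>Ergodicity of the chain also requires that almost no mass enters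
    \<open>R\<close> from outside. By stationarity the points of \<open>R\<close>, each sending all
    its mass into \<open>R\<close>, already account for the whole measure of
    \<open>R\<close>.\<close>
  have "AE x in \<mu>. emeasure (Q x) R = indicator R x"
  proof -
    note meas[measurable] = emeasure_Q_measurable[OF R_sets]
    have [measurable]: "R \<in> sets \<mu>" using R_sets sets_\<mu> by simp
    let ?g = "\<lambda>x. emeasure (Q x) R * indicator (M - R) x"
    have [measurable]: "M - R \<in> sets \<mu>" using sets.compl_sets[of R \<mu>] R_sets sets_\<mu> space_\<mu> by simp
    have "emeasure \<mu> R = (\<integral>\<^sup>+x. emeasure (Q x) R \<partial>\<mu>)" by (rule stationary[OF R_sets])
    also have "\<dots> = (\<integral>\<^sup>+x. indicator R x + ?g x \<partial>\<mu>)"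
      using QR by (intro nn_integral_cong) (auto simp: indicator_def space_\<mu>)
    also have "\<dots> = emeasure \<mu> R + (\<integral>\<^sup>+x. ?g x \<partial>\<mu>)"
      by (subst nn_integral_add) auto
    finally have "(\<integral>\<^sup>+x. ?g x \<partial>\<mu>) = 0"
      using \<mu>.emeasure_finite[of R] by (simp add: \<mu>.emeasure_eq_measure)
    then have "AE x in \<mu>. ?g x = 0" by (subst (asm) nn_integral_0_iff_AE) auto
    moreover have "AE x in \<mu>. x \<in> M" using AE_space[of \<mu>] by (simp add: space_\<mu>)
    ultimately show ?thesis
      by eventually_elim (use QR in \<open>auto simp: indicator_def split: if_splits\<close>)
  qed
  then have "AE x in \<mu>. measure (Q x) R = indicator R x"
    by eventually_elim (auto simp: measure_def indicator_def)
  then have R01: "measure \<mu> R \<in> {0, 1}"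
    using ergodic R_sets by (auto simp: ergodic_acsm_def)
  obtain x0 where x0: "x0 \<in> \<Lambda>" using ergodic_support_nonempty[OF \<Lambda>(1)] by blast
  have "x0 \<in> S" "x0 \<in> R" using x0 \<Lambda> \<Lambda>R by auto
  then have "emeasure \<mu> R > 0"
    using \<open>open U\<close> R_eq by (auto simp: measure_support_def space_\<mu>)
  then have "measure \<mu> R = 1" using R01 by (auto simp: \<mu>.emeasure_eq_measure)
  then have "AE x in \<mu>. x \<in> R" using \<mu>.prob_eq_1[of R] R_sets by (simp add: sets_\<mu>)
  \<comment> \<open>\<open>y\<close> may lie outside \<open>R\<close>, but points of
    \<open>R\<close> are arbitrarily close to it; the distance is absorbed into the last step, whose
    tolerance grows from \<open>\<epsilon>\<close> to \<open>e\<close>.\<close>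
  then obtain z where z: "z \<in> R" "dist z y < e - \<epsilon>"
    using support_witness[OF sets_\<mu> y, of "ball y (e - \<epsilon>)" "\<lambda>x. x \<in> R"] e
    by (auto simp: dist_commute)
  have yM: "y \<in> M" using y support_subset_M[OF sets_\<mu>] by blast
  obtain x where x: "x \<in> \<Lambda>" "(eps_step M T \<epsilon>)\<^sup>+\<^sup>+ x z" using z(1) by (auto simp: R_def)
  then obtain w where w: "(eps_step M T \<epsilon>)\<^sup>*\<^sup>* x w" "eps_step M T \<epsilon> w z"
    by (metis tranclp.cases r_into_rtranclp rtranclp.rtrancl_refl tranclp_into_rtranclp)
  have "dist (T w) y \<le> dist (T w) z + dist z y" by (rule dist_triangle)
  then have "eps_step M T e w y" using w(2) z(2) yM by (auto simp: eps_step_def)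
  moreover have "(eps_step M T e)\<^sup>*\<^sup>* x w"
    using w(1) by (rule rtranclp_mono[THEN predicate2D, rotated]) (use e eps_step_mono in fastforce)
  ultimately show ?thesis using x(1) by (meson rtranclp.rtrancl_into_rtrancl)
qed

end

theorem corollary2p11:
  fixes M :: "'a::euclidean_space set"
    and T :: "'a \<Rightarrow> 'a"
    and P :: "real \<Rightarrow> 'a \<Rightarrow> 'a measure"
    and p :: "real \<Rightarrow> 'a \<Rightarrow> 'a \<Rightarrow> real"
    and B :: "('a \<Rightarrow> real) set"
    and sn :: "('a \<Rightarrow> real) \<Rightarrow> real"
    and \<eta> D :: real
  assumes "initial_system M T"
    and "limit_values M T"
    and "transition_probabilities M P"
    and "P1 M P p"
    and "P2 M T P p"
    and "B1 B"
    and "B2 M B"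
    and "B3 M B sn"
    and "L1_dense M B"
    and "0 < \<eta>" and "\<eta> < 1" and "0 < D"
    and "LY M T B sn \<eta> D"
    and "RLY M p B sn \<eta> D"
  shows "\<exists>\<epsilon>\<^sub>0>0. \<forall>\<epsilon>. 0 < \<epsilon> \<and> \<epsilon> < \<epsilon>\<^sub>0 \<longrightarrow>
    (\<forall>\<mu>. ergodic_acsm M (P \<epsilon>) \<mu> \<longrightarrow>
      (\<exists>!C. least_element M T C \<and> \<Union>C \<subseteq> measure_support \<mu>))"
proof -
  interpret lasota_yorke M T B sn \<eta> D
    using assms by unfold_locales auto
  obtain \<epsilon>\<^sub>0 where \<epsilon>\<^sub>0: "\<epsilon>\<^sub>0 > 0" "\<And>\<Lambda> \<Lambda>' x y. \<Lambda> \<in> ergodic_supports M T \<Longrightarrow> \<Lambda>' \<in> ergodic_supports M T \<Longrightarrow>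
      x \<in> \<Lambda> \<Longrightarrow> y \<in> \<Lambda>' \<Longrightarrow> (eps_step M T \<epsilon>\<^sub>0)\<^sup>*\<^sup>* x y \<Longrightarrow> leads_to M T \<Lambda> \<Lambda>'"
    using leads_to_threshold by blast
  have "\<exists>!C. least_element M T C \<and> \<Union>C \<subseteq> measure_support \<mu>"
    if pos: "0 < \<epsilon>" and small: "\<epsilon> < \<epsilon>\<^sub>0" and erg: "ergodic_acsm M (P \<epsilon>) \<mu>" for \<epsilon> \<mu>
  proof -
    have joint: "(\<lambda>(x, y). p \<epsilon> x y) \<in> borel_measurable (m \<Otimes>\<^sub>M m)"
      and dens: "\<And>x. x \<in> M \<Longrightarrow> P \<epsilon> x = density m (\<lambda>y. ennreal (p \<epsilon> x y))"
      using \<open>P1 M P p\<close> pos unfolding P1_def by blast+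
    have "p \<epsilon> x \<in> borel_measurable m" if "x \<in> M" for x
      using measurable_compose[OF measurable_Pair1'[of x m m] joint] that by simp
    then have density: "p \<epsilon> x \<in> borel_measurable m \<and> P \<epsilon> x = density m (\<lambda>y. ennreal (p \<epsilon> x y))"
      if "x \<in> M" for x
      using dens that by blast
    have kernel: "P \<epsilon> \<in> m \<rightarrow>\<^sub>M prob_algebra m"
      using \<open>transition_probabilities M P\<close> pos by (simp add: transition_probabilities_def)
    have positive: "p \<epsilon> x y > 0" if "x \<in> M" "y \<in> relball M \<epsilon> (T x)" for x y
      using \<open>P2 M T P p\<close> pos that by (simp add: P2_def)
    have outside: "emeasure (P \<epsilon> x) (M - relball M \<epsilon> (T x)) = 0" if "x \<in> M" for x
      using \<open>P2 M T P p\<close> pos that by (simp add: P2_def)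
    interpret random_perturbation M T "P \<epsilon>" "p \<epsilon>" \<epsilon> \<mu>
      by unfold_locales (fact pos \<open>limit_values M T\<close> kernel density positive outside erg)+
    show ?thesis
    proof (rule ex_ex1I)
      obtain \<nu> where \<nu>: "ergodic_acim M T \<nu>" "AE x in \<nu>. x \<in> core"
        using ergodic_acim_in_forward_invariant[OF core_sets T_core core_pos] by blast
      then have \<Lambda>: "measure_support \<nu> \<in> ergodic_supports M T" by (auto simp: ergodic_supports_def)
      show "\<exists>C. least_element M T C \<and> \<Union>C \<subseteq> S"
        using least_element_reachable[OF \<Lambda>] leads_to_subset_support[OF ergodic_support_in_core[OF \<nu>]]
        by (meson Union_least)
    next
      \<comment> \<open>Used with \<open>e = \<epsilon>\<^sub>0\<close>, the scale at which one
        chain between two supports already implies \<open>leads_to\<close>. All classes inside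
        \<open>S\<close> thus lead to each other, which leastness allows only for equal
        ones.\<close>
      have leads: "class_leads_to M T C C'"
        if C: "C \<in> support_classes M T" "\<Union>C \<subseteq> S" and C': "C' \<in> support_classes M T" "\<Union>C' \<subseteq> S" for C C'
      proof -
        obtain \<Lambda> where \<Lambda>: "\<Lambda> \<in> ergodic_supports M T" "C = support_equiv M T `` {\<Lambda>}" "\<Lambda> \<in> C"
          using support_classesE[OF C(1)] by blast
        obtain \<Lambda>' where \<Lambda>': "\<Lambda>' \<in> ergodic_supports M T" "C' = support_equiv M T `` {\<Lambda>'}" "\<Lambda>' \<in> C'"
          using support_classesE[OF C'(1)] by blast
        obtain y where y: "y \<in> \<Lambda>'" using ergodic_support_nonempty[OF \<Lambda>'(1)] by blast
        have "\<Lambda> \<subseteq> S" "y \<in> S" using \<Lambda>(3) \<Lambda>'(3) y C(2) C'(2) by blast+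
        then obtain x where "x \<in> \<Lambda>" "(eps_step M T \<epsilon>\<^sub>0)\<^sup>*\<^sup>* x y"
          using eps_chain_between[OF \<Lambda>(1) _ _ small] by blast
        then have "leads_to M T \<Lambda> \<Lambda>'" using \<epsilon>\<^sub>0(2) \<Lambda>(1) \<Lambda>'(1) y by blast
        then show ?thesis using class_leads_to_iff[OF \<Lambda>(1) \<Lambda>'(1)] \<Lambda>(2) \<Lambda>'(2) by simp
      qed
      fix C C' assume C: "least_element M T C \<and> \<Union>C \<subseteq> S" and C': "least_element M T C' \<and> \<Union>C' \<subseteq> S"
      then have "class_leads_to M T C C'" "C' \<in> support_classes M T"
        using leads by (auto simp: least_element_def)
      then show "C = C'" using C by (auto simp: least_element_def)
    qed
  qed
  then show ?thesis by (intro exI[of _ \<epsilon>\<^sub>0] conjI \<epsilon>\<^sub>0(1) allI impI) (elim conjE)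
qed

end
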